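(* Let $N\ge 2$ and $K\le N$ be powers of two, let $\mathcal X$ be a subset of the unit $2$-norm ball of $\mathbb R^N$, let $P$ be a probability distribution on $\mathcal X$, let $p\in[1,\infty]$ and let $f:\mathcal X\to\mathbb R$. For $\vec x\in\mathcal X$ let $\hat x=F_N\vec x$, where $F_N$ is the $N\times N$ unitary discrete Fourier matrix, and let $\hat B^K_\rho\subset\mathbb C^K$ be the $2$-norm ball of radius $\rho$. Assume there are constants $C_2>0$, $s>0$, $c(s,K)>0$ (depending on $s$ and $K$), an interval $I_K=[K_0,K_0+K)$ of $K$ consecutive frequency indices, and a function $g_K:\hat B^K_{1.1}\to\mathbb R$ such that: (i) $\|f(\vec x)-g_K(\hat x|_{I_K})\|_{L^p(\mathcal X,dP)}<0.1$, where $\hat x|_{I_K}$ is the vector of entries of $\hat x$ with index in $I_K$; (ii) $|g_K(z)-g_K(z')|\le C_2\|z-z'\|_2$ for all $z,z'\in\hat B^K_{1.1}$; (iii) for every $0<\varepsilon<1$ there is a multi-layer fully-connected network with at most $c(s,K)\,\varepsilon^{-K/s}(\log\frac1\varepsilon+1)$ parameters whose network mapping $\phi_K:\hat B^K_{1.1}\to\mathbb R$ satisfies $\sup_{z\in\hat B^K_{1.1}}|\phi_K(z)-g_K(z)|<\varepsilon$. Then there is an absolute constant $C$ such that, for every $\varepsilon>0$ satisfying $$\|f(\vec x)-g_K(\hat x|_{I_K})\|_{L^p(\mathcal X,dP)}\le\varepsilon<0.1,$$ there exist a family of Butterfly-nets $\mathcal B$ with input size $N$ and output size $K$, one for each $L_\xi=0,1,\dots,\log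 K$, whose numbers of parameters $n_b$ are all bounded by $$n_b\le C\,K\log N\left(\log\tfrac1\varepsilon+\log N\right)^2,$$ and a fully-connected network $\phi_K$ with number of parameters $$n_{fc}\le c(s,K)\,\varepsilon^{-K/s}\left(\log\tfrac1\varepsilon+1\right),$$ such that for every member $\mathcal B$ of the family, $$\|f(\vec x)-\phi_K(\mathcal B(\vec x))\|_{L^p(\mathcal X,dP)}\le\varepsilon(2+C_2).$$ Here $C$ does not depend on $N,K,\varepsilon,f,\mathcal X,P,p$ or any other data.
   Context: Conventions: $\log$ is base $2$. A fully-connected network on $\hat B^K_{1.1}\subset\mathbb C^K\cong\mathbb R^{2K}$ is a feed-forward ReLU network taking $2K$ real inputs; its number of parameters is its number of weights and biases. Definition of a Butterfly-net with input size $N$, output size $K$ ($K\le N$ powers of two), depth $L\le\log N$, $r$ mixing channels ($r$ a positive integer), and split $L=L_t+L_\xi$ with integers $L_t\ge0$, $0\le L_\xi\le\log K$. Put $L_{\min}=\min(L_t,\log K-L_\xi)$ and $n_A(\ell)=2^{\ell}$ for $0\le\ell\le L_{\min}$, $n_A(\ell)=2^{L_{\min}}$ for $L_{\min}<\ell\le L_t$, $n_A(\ell)=2^{\ell-L_t+L_{\min}}$ for $L_t<\ell\le L$. Put $m=K/n_A(L)=\max(1,K/2^L)$. A complex number $z$ is encoded as the real $4$-vector $E(z)=((\Re z)_+,(\Im z)_+,(\Re z)_-,(\Im z)_-)$ with $(u)_+=\max(u,0)$, $(u)_-=-\min(u,0)$, and a real $4$-vector $u$ is decoded as $D(u)=(u_1-u_3)+\imath(u_2-u_4)$.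 All hidden quantities $\lambda^{(\ell)}(i,j,k)$ ($0\le i<n_A(\ell)$, $0\le j<2^{L-\ell}$, $1\le k\le r$) are in $\mathbb R^4$; every weight $W$ below is an arbitrary real $4\times4$ matrix, every bias $b$ an arbitrary vector in $\mathbb R^4$, and $\sigma$ is the entrywise ReLU. On input $x=(x_1,\dots,x_N)$ the net computes: 1. $\lambda^{(0)}(0,j,k)=\sigma\big(b^{(0)}_k+\sum_{q=1}^{N/2^L}W^{(0)}_{k,q}E(x_{jN/2^L+q})\big)$. 2. For $\ell=1,\dots,L_t$: $\lambda^{(\ell)}(i,j,k)=\sigma\big(b^{(\ell),i}_k+\sum_{c=0}^{1}\sum_{s=1}^rW^{(\ell),i}_{k,c,s}\lambda^{(\ell-1)}(i',2j+c,s)\big)$, where $i'=\lfloor i/2\rfloor$ if $\ell\le L_{\min}$ and $i'=i$ if $L_{\min}<\ell\le L_t$. 3. (Switch) $\lambda^{(L_t)}(i,j,k)$ is replaced by $\sigma\big(b^{i,j}_k+\sum_{s=1}^rW^{i,j}_{k,s}\lambda^{(L_t)}(i,j,s)\big)$, for all $i,j$. 4. For $\ell=L_t+1,\dots,L$: $\lambda^{(\ell)}(i,j,k)=\sigma\big(b^{(\ell),j}_k+\sum_{c=0}^{1}\sum_{s=1}^rW^{(\ell),j,a}_{k,c,s}\lambda^{(\ell-1)}(\lfloor i/2\rfloor,2j+c,s)\big)$ with $a=i\bmod2$. 5. The output $\mathcal B(x)\in\mathbb C^K$ has entries $\mathcal B(x)_{im+q}=D\big(\sigma\big(b^{(L)}_q+\sum_{k=1}^rW^{(L)}_{q,k}\lambda^{(L)}(i,0,k)\big)\big)$,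 $0\le i<n_A(L)$, $1\le q\le m$. The number of parameters is the total number of real entries of all weights $W$ and biases $b$. The claim's Butterfly-nets may use any admissible $L$ and $r$. *)

theory Defs
  imports "HOL-Probability.Probability"
begin

section \<open>Vectors, balls and the discrete Fourier transform\<close>

text \<open>
  The dimensions are quantified inside the theorem, so a vector of length \<open>n\<close> is an
  extensional function on \<open>{..<n}\<close>, i.e. a point of the space of
  \<open>Pi\<^sub>M {..<n} (\<lambda>_. borel)\<close>.  All indices start at 0.
\<close>

definition vec_cball :: "nat \<Rightarrow> real \<Rightarrow> (nat \<Rightarrow> 'a::real_normed_vector) set" where
  "vec_cball n \<rho> = {v \<in> {..<n} \<rightarrow>\<^sub>E UNIV. L2_set (\<lambda>i. norm (v i)) {..<n} \<le> \<rho>}"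

text \<open>
  The matrix entry is \<open>N\<close>-periodic in the frequency index, so an arbitrary integer index
  covers both the index ranges \<open>[0, N)\<close> and \<open>[-N/2, N/2)\<close>.
\<close>

definition dft :: "nat \<Rightarrow> (nat \<Rightarrow> real) \<Rightarrow> int \<Rightarrow> complex" where
  "dft N x \<xi> = (\<Sum>t<N. exp (- 2 * of_real pi * \<i> * of_int \<xi> * of_nat t / of_nat N)
                  / of_real (sqrt (real N)) * of_real (x t))"

definition dft_on :: "nat \<Rightarrow> nat \<Rightarrow> int \<Rightarrow> (nat \<Rightarrow> real) \<Rightarrow> nat \<Rightarrow> complex" where
  "dft_on N K K0 x = (\<lambda>j\<in>{..<K}. dft N x (K0 + int j))"

section \<open>The $L^p$ norm\<close>

text \<open>As for \<^const>\<open>esssup\<close>, the norm of a non-measurable function is infinite.\<close>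

definition Lp_norm :: "'a measure \<Rightarrow> ennreal \<Rightarrow> ('a \<Rightarrow> real) \<Rightarrow> ennreal" where
  "Lp_norm M p h =
    (if h \<notin> borel_measurable M then \<infinity>
     else if p = \<infinity> then esssup M (\<lambda>x. ennreal \<bar>h x\<bar>)
     else let I = (\<integral>\<^sup>+ x. ennreal (\<bar>h x\<bar> powr enn2real p) \<partial>M)
          in if I = \<infinity> then \<infinity> else ennreal (enn2real I powr (1 / enn2real p)))"

section \<open>Fully-connected ReLU networks\<close>

text \<open>
  A layer consists of its width, its weights \<open>W i j\<close> (output \<open>i\<close>, input \<open>j\<close>) and its biases.
  The ReLU follows every layer but the last one, which is affine.
\<close>

type_synonym fc_net = "(nat \<times> (nat \<Rightarrow> nat \<Rightarrow> real) \<times> (nat \<Rightarrow> real)) list"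

fun fc_eval :: "nat \<Rightarrow> fc_net \<Rightarrow> (nat \<Rightarrow> real) \<Rightarrow> (nat \<Rightarrow> real)" where
  "fc_eval d [] v = v"
| "fc_eval d [(n, W, b)] v = (\<lambda>i. b i + (\<Sum>j<d. W i j * v j))"
| "fc_eval d ((n, W, b) # l # ls) v =
     fc_eval n (l # ls) (\<lambda>i. max (b i + (\<Sum>j<d. W i j * v j)) 0)"

fun fc_params :: "nat \<Rightarrow> fc_net \<Rightarrow> nat" where
  "fc_params d [] = 0"
| "fc_params d ((n, W, b) # ls) = n * d + n + fc_params n ls"

text \<open>Multi-layer: at least one hidden layer.\<close>

definition fc_scalar_net :: "fc_net \<Rightarrow> bool" where
  "fc_scalar_net \<Phi> \<longleftrightarrow> length \<Phi> \<ge> 2 \<and> (\<forall>l\<in>set \<Phi>. fst l > 0) \<and> fst (last \<Phi>) = 1"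

definition fc_map :: "nat \<Rightarrow> fc_net \<Rightarrow> (nat \<Rightarrow> complex) \<Rightarrow> real" where
  "fc_map K \<Phi> z =
     fc_eval (2 * K) \<Phi> (\<lambda>i. if even i then Re (z (i div 2)) else Im (z (i div 2))) 0"

section \<open>Butterfly-nets\<close>

definition cplx_enc :: "complex \<Rightarrow> real ^ 4" where
  "cplx_enc z = vector [max (Re z) 0, max (Im z) 0, - min (Re z) 0, - min (Im z) 0]"

definition cplx_dec :: "real ^ 4 \<Rightarrow> complex" where
  "cplx_dec u = Complex (u $ 1 - u $ 3) (u $ 2 - u $ 4)"

definition relu4 :: "real ^ 4 \<Rightarrow> real ^ 4" where
  "relu4 u = (\<chi> i. max (u $ i) 0)"

text \<open>
  The argument order of the weights and biases is
  \<open>W0 k q\<close>, \<open>b0 k\<close>; \<open>WT l i k c s\<close>, \<open>bT l i k\<close> (layers \<open>1 \<le> l \<le> L\<^sub>t\<close>);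
  \<open>WS i j k s\<close>, \<open>bS i j k\<close> (switch);
  \<open>WX l j a k c s\<close>, \<open>bX l j k\<close> (layers \<open>L\<^sub>t < l \<le> L\<close>);
  \<open>WL q k\<close>, \<open>bL q\<close> (output).
\<close>

record butterfly_net =
  Lt :: nat
  Lxi :: nat
  chan :: nat
  W0 :: "nat \<Rightarrow> nat \<Rightarrow> real ^ 4 ^ 4"
  b0 :: "nat \<Rightarrow> real ^ 4"
  WT :: "nat \<Rightarrow> nat \<Rightarrow> nat \<Rightarrow> nat \<Rightarrow> nat \<Rightarrow> real ^ 4 ^ 4"
  bT :: "nat \<Rightarrow> nat \<Rightarrow> nat \<Rightarrow> real ^ 4"
  WS :: "nat \<Rightarrow> nat \<Rightarrow> nat \<Rightarrow> nat \<Rightarrow> real ^ 4 ^ 4"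
  bS :: "nat \<Rightarrow> nat \<Rightarrow> nat \<Rightarrow> real ^ 4"
  WX :: "nat \<Rightarrow> nat \<Rightarrow> nat \<Rightarrow> nat \<Rightarrow> nat \<Rightarrow> nat \<Rightarrow> real ^ 4 ^ 4"
  bX :: "nat \<Rightarrow> nat \<Rightarrow> nat \<Rightarrow> real ^ 4"
  WL :: "nat \<Rightarrow> nat \<Rightarrow> real ^ 4 ^ 4"
  bL :: "nat \<Rightarrow> real ^ 4"

definition depth :: "butterfly_net \<Rightarrow> nat" where
  "depth B = Lt B + Lxi B"

text \<open>From here on the input size is \<open>N = 2 ^ n\<close> and the output size is \<open>K = 2 ^ \<kappa>\<close>.\<close>

definition bf_admissible :: "nat \<Rightarrow> nat \<Rightarrow> butterfly_net \<Rightarrow> bool" where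
  "bf_admissible n \<kappa> B \<longleftrightarrow> \<kappa> \<le> n \<and> depth B \<le> n \<and> Lxi B \<le> \<kappa> \<and> chan B \<ge> 1"

definition Lmin :: "nat \<Rightarrow> butterfly_net \<Rightarrow> nat" where
  "Lmin \<kappa> B = min (Lt B) (\<kappa> - Lxi B)"

definition nA :: "nat \<Rightarrow> butterfly_net \<Rightarrow> nat \<Rightarrow> nat" where
  "nA \<kappa> B l =
     (if l \<le> Lmin \<kappa> B then 2 ^ l
      else if l \<le> Lt B then 2 ^ Lmin \<kappa> B
      else 2 ^ (l - Lt B + Lmin \<kappa> B))"

definition out_block :: "nat \<Rightarrow> butterfly_net \<Rightarrow> nat" where
  "out_block \<kappa> B = 2 ^ \<kappa> div nA \<kappa> B (depth B)"

fun lamT :: "nat \<Rightarrow> nat \<Rightarrow> butterfly_net \<Rightarrow> (nat \<Rightarrow> real) \<Rightarrow> nat \<Rightarrow> nat \<Rightarrow> nat \<Rightarrow> nat \<Rightarrow> real ^ 4" where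
  "lamT n \<kappa> B x 0 i j k =
     relu4 (b0 B k + (\<Sum>q<2 ^ (n - depth B).
       W0 B k q *v cplx_enc (of_real (x (j * 2 ^ (n - depth B) + q)))))"
| "lamT n \<kappa> B x (Suc l) i j k =
     relu4 (bT B (Suc l) i k + (\<Sum>c<2. \<Sum>s<chan B.
       WT B (Suc l) i k c s *v
         lamT n \<kappa> B x l (if Suc l \<le> Lmin \<kappa> B then i div 2 else i) (2 * j + c) s))"

definition lamS :: "nat \<Rightarrow> nat \<Rightarrow> butterfly_net \<Rightarrow> (nat \<Rightarrow> real) \<Rightarrow> nat \<Rightarrow> nat \<Rightarrow> nat \<Rightarrow> real ^ 4" where
  "lamS n \<kappa> B x i j k =
     relu4 (bS B i j k + (\<Sum>s<chan B. WS B i j k s *v lamT n \<kappa> B x (Lt B) i j s))"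

text \<open>\<open>lamX\<close> at \<open>d\<close> is the hidden layer \<open>l = L\<^sub>t + d\<close> (after the switch if \<open>d = 0\<close>).\<close>

fun lamX :: "nat \<Rightarrow> nat \<Rightarrow> butterfly_net \<Rightarrow> (nat \<Rightarrow> real) \<Rightarrow> nat \<Rightarrow> nat \<Rightarrow> nat \<Rightarrow> nat \<Rightarrow> real ^ 4" where
  "lamX n \<kappa> B x 0 i j k = lamS n \<kappa> B x i j k"
| "lamX n \<kappa> B x (Suc d) i j k =
     relu4 (bX B (Lt B + Suc d) j k + (\<Sum>c<2. \<Sum>s<chan B.
       WX B (Lt B + Suc d) j (i mod 2) k c s *v
         lamX n \<kappa> B x d (i div 2) (2 * j + c) s))"

definition bf_map :: "nat \<Rightarrow> nat \<Rightarrow> butterfly_net \<Rightarrow> (nat \<Rightarrow> real) \<Rightarrow> (nat \<Rightarrow> complex)" where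
  "bf_map n \<kappa> B x = (\<lambda>p\<in>{..<2 ^ \<kappa>}.
     let i = p div out_block \<kappa> B; q = p mod out_block \<kappa> B in
     cplx_dec (relu4 (bL B q + (\<Sum>k<chan B. WL B q k *v lamX n \<kappa> B x (Lxi B) i 0 k))))"

text \<open>Each weight has 16 real entries and each bias 4; the summands follow the layers in order.\<close>

definition bf_params :: "nat \<Rightarrow> nat \<Rightarrow> butterfly_net \<Rightarrow> nat" where
  "bf_params n \<kappa> B =
     (let r = chan B; L = depth B in
       (4 * r + 16 * (r * 2 ^ (n - L)))
     + (\<Sum>l=1..Lt B. nA \<kappa> B l * (4 * r + 16 * (r * 2 * r)))
     + nA \<kappa> B (Lt B) * 2 ^ (L - Lt B) * (4 * r + 16 * (r * r))
     + (\<Sum>l=Lt B + 1..L. 2 ^ (L - l) * (4 * r + 16 * (2 * r * 2 * r)))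
     + out_block \<kappa> B * (4 + 16 * r))"

end

theory Submission
  imports Defs
begin

text \<open>
  On a time box of \<open>2 ^ l\<close> samples and a frequency box of \<open>2 ^ e\<close> frequencies with \<open>e + l \<le> n\<close> the phase
  \<open>2 \<pi> \<xi> t / N\<close> varies by at most \<open>2 \<pi>\<close>, so the partial Fourier sum over the time box is, up to a
  unimodular factor, an entire function of the normalized frequency offset which is approximated by
  its first \<open>r\<close> Taylor coefficients up to a relative error \<open>O (2 ^ - r)\<close>.  The channels store these
  coefficients.  Halving the frequency box and merging two time boxes is an affine substitution
  followed by a multiplication by an exponential, i.e. a linear map of the coefficients whose norm
  is bounded by an absolute constant.  Over \<open>n = log N\<close> layers the error therefore grows by a power of \<open>N\<close> only,
  and \<open>r = O (log (1 / \<epsilon>) + log N)\<close> channels suffice.  Complex linear maps are computed exactly by the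
  ReLU layers, since a complex number and its negative are encoded by separate nonnegative entries.
\<close>

section \<open>Perturbation of the $L^p$ norm\<close>

text \<open>Convexity of \<open>t \<mapsto> t powr p\<close> at the points
  \<open>a / \<epsilon>\<close> and \<open>1\<close>. The weights are chosen so that, once the
  integral of \<open>a powr p\<close> is at most \<open>\<epsilon> powr p\<close>, integration gives
  the bound \<open>(\<epsilon> + c) powr p\<close> without any loss.\<close>

lemma powr_add_le_weighted:
  fixes a \<epsilon> c p :: real
  assumes "a \<ge> 0" "\<epsilon> > 0" "c > 0" "p \<ge> 1"
  shows "(a + c) powr p \<le> (\<epsilon> + c) powr p * (\<epsilon> / (\<epsilon> + c) * (a powr p / \<epsilon> powr p) + c / (\<epsilon> + c))"
proof -
  let ?l = "\<epsilon> / (\<epsilon> + c)"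
  have l: "0 < ?l" "?l < 1" and c: "c / (\<epsilon> + c) = 1 - ?l"
    using assms by (auto simp: field_simps)
  have "(?l * (a / \<epsilon>) + (1 - ?l)) powr p \<le> ?l * (a / \<epsilon>) powr p + (1 - ?l)"
  proof (cases "a = 0")
    case True
    \<comment> \<open>Since \<open>0 powr p = 0\<close>, only \<open>t powr p \<le> t\<close> for
      \<open>t\<close> in the unit interval remains.\<close>
    have "(1 - ?l) powr p \<le> (1 - ?l) powr 1"
      using l assms by (intro powr_mono') auto
    then show ?thesis using True l by simp
  next
    case False
    then have "a / \<epsilon> > 0" using assms by simp
    then show ?thesis
      using convex_onD[OF powr_convex[OF \<open>p \<ge> 1\<close>], of "1 - ?l" "a / \<epsilon>" 1] l by simp
  qed
  moreover have "a + c = (\<epsilon> + c) * (?l * (a / \<epsilon>) + (1 - ?l))"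
  proof -
    have "?l * (a / \<epsilon>) + c / (\<epsilon> + c) = (a + c) / (\<epsilon> + c)"
      using assms by (simp add: add_divide_distrib)
    then show ?thesis unfolding c[symmetric] using assms by simp
  qed
  ultimately show ?thesis
    unfolding c using assms l
    by (simp add: powr_mult powr_divide mult_left_mono)
qed

text \<open>If the integral is infinite, both sides are false; otherwise monotonicity of powers
  removes the root. Bounds can then be proved for the integral itself, which is additive.\<close>

lemma Lp_norm_finite_le_iff:
  assumes "h \<in> borel_measurable M" "p \<ge> 1" "p \<noteq> \<infinity>" "\<epsilon> \<ge> 0"
  shows "Lp_norm M p h \<le> ennreal \<epsilon> \<longleftrightarrow>
    (\<integral>\<^sup>+ x. ennreal (\<bar>h x\<bar> powr enn2real p) \<partial>M) \<le> ennreal (\<epsilon> powr enn2real p)"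
proof -
  define q where "q = enn2real p"
  define I where "I = (\<integral>\<^sup>+ x. ennreal (\<bar>h x\<bar> powr q) \<partial>M)"
  have q: "q \<ge> 1"
    using enn2real_mono[of 1 p] assms by (auto simp: q_def less_top)
  show ?thesis
  proof (cases "I = \<infinity>")
    case True
    then show ?thesis using assms(1,3) by (simp add: Lp_norm_def q_def[symmetric] I_def[symmetric] top_unique)
  next
    case False
    define i where "i = enn2real I"
    have I: "I = ennreal i" and i: "i \<ge> 0"
      using False by (auto simp: i_def less_top)
    have "i powr (1 / q) \<le> \<epsilon> \<longleftrightarrow> i \<le> \<epsilon> powr q"
    proof
      assume "i powr (1 / q) \<le> \<epsilon>"
      then have "(i powr (1 / q)) powr q \<le> \<epsilon> powr q"
        using q by (intro powr_mono2) auto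
      then show "i \<le> \<epsilon> powr q" using q i by (simp add: powr_powr)
    next
      assume "i \<le> \<epsilon> powr q"
      then have "i powr (1 / q) \<le> (\<epsilon> powr q) powr (1 / q)"
        using q i by (intro powr_mono2) auto
      then show "i powr (1 / q) \<le> \<epsilon>" using q assms(4) by (simp add: powr_powr)
    qed
    then show ?thesis
      using assms False i
      by (simp add: Lp_norm_def I_def[symmetric] q_def[symmetric] Let_def I)
  qed
qed

text \<open>The \<open>L\<^sup>p\<close> triangle inequality is needed only for a bounded perturbation on a probability space,
  where it is the integrated form of the convexity inequality above.\<close>

lemma Lp_norm_perturb:
  assumes "prob_space M" "p \<ge> 1" "\<epsilon> > 0" "\<delta> > 0"
    and le: "Lp_norm M p h \<le> ennreal \<epsilon>"
    and h': "h' \<in> borel_measurable M" "\<And>x. x \<in> space M \<Longrightarrow> \<bar>h' x\<bar> \<le> \<bar>h x\<bar> + \<delta>"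
  shows "Lp_norm M p h' \<le> ennreal (\<epsilon> + \<delta>)"
proof -
  interpret prob_space M by fact
  have h[measurable]: "h \<in> borel_measurable M"
    using le by (auto simp: Lp_norm_def top_unique split: if_splits)
  show ?thesis
  proof (cases "p = \<infinity>")
    case True
    have "AE x in M. ennreal \<bar>h x\<bar> \<le> ennreal \<epsilon>"
      using le esssup_AE[where M = M and f = "\<lambda>x. ennreal \<bar>h x\<bar>"] True h
      by (auto simp: Lp_norm_def elim!: eventually_mono intro: order.trans)
    moreover have "AE x in M. \<bar>h' x\<bar> \<le> \<bar>h x\<bar> + \<delta>"
      using h'(2) by (rule AE_I2)
    ultimately have "AE x in M. ennreal \<bar>h' x\<bar> \<le> ennreal (\<epsilon> + \<delta>)"
    proof eventually_elim
      case (elim x)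
      then have "\<bar>h x\<bar> \<le> \<epsilon>" using assms(3) by simp
      then show ?case using elim(2) by (intro ennreal_leI) linarith
    qed
    then show ?thesis
      using True h'(1) by (auto simp: Lp_norm_def intro!: esssup_I)
  next
    case False
    define q where "q = enn2real p"
    have q: "q \<ge> 1"
      using enn2real_mono[of 1 p] assms False by (auto simp: q_def less_top)
    let ?A = "(\<epsilon> + \<delta>) powr q * (\<epsilon> / (\<epsilon> + \<delta>) / \<epsilon> powr q)"
    let ?B = "(\<epsilon> + \<delta>) powr q * (\<delta> / (\<epsilon> + \<delta>))"
    have "(\<integral>\<^sup>+ x. ennreal (\<bar>h' x\<bar> powr q) \<partial>M) \<le> (\<integral>\<^sup>+ x. ennreal ?A * ennreal (\<bar>h x\<bar> powr q) + ennreal ?B \<partial>M)"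
    proof (rule nn_integral_mono)
      fix x assume x: "x \<in> space M"
      have "\<bar>h' x\<bar> powr q \<le> (\<bar>h x\<bar> + \<delta>) powr q"
        using h'(2)[OF x] q by (intro powr_mono2) auto
      also have "\<dots> \<le> ?A * \<bar>h x\<bar> powr q + ?B"
        using powr_add_le_weighted[of "\<bar>h x\<bar>" \<epsilon> \<delta> q] assms q by (simp add: algebra_simps)
      finally show "ennreal (\<bar>h' x\<bar> powr q) \<le> ennreal ?A * ennreal (\<bar>h x\<bar> powr q) + ennreal ?B"
        using assms by (simp add: ennreal_leI flip: ennreal_mult ennreal_plus)
    qed
    also have "\<dots> = ennreal ?A * (\<integral>\<^sup>+ x. ennreal (\<bar>h x\<bar> powr q) \<partial>M) + ennreal ?B"
      by (simp add: nn_integral_add nn_integral_cmult emeasure_space_1)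
    also have "\<dots> \<le> ennreal ?A * ennreal (\<epsilon> powr q) + ennreal ?B"
      using Lp_norm_finite_le_iff[OF h \<open>p \<ge> 1\<close> False, of \<epsilon>] le assms
      by (intro add_right_mono mult_left_mono) (auto simp: q_def)
    also have "\<dots> = ennreal (?A * \<epsilon> powr q + ?B)"
      using assms by (simp flip: ennreal_mult ennreal_plus)
    also have "?A * \<epsilon> powr q + ?B = (\<epsilon> + \<delta>) powr q * (\<epsilon> / (\<epsilon> + \<delta>) + \<delta> / (\<epsilon> + \<delta>))"
    proof -
      have "?A * \<epsilon> powr q = (\<epsilon> + \<delta>) powr q * (\<epsilon> / (\<epsilon> + \<delta>))"
        using assms by simp
      then show ?thesis by (simp only: distrib_left)
    qed
    also have "\<dots> = (\<epsilon> + \<delta>) powr q"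
      using assms by (simp flip: add_divide_distrib)
    finally show ?thesis
      using Lp_norm_finite_le_iff[OF h'(1) \<open>p \<ge> 1\<close> False, of "\<epsilon> + \<delta>"] assms by (simp add: q_def)
  qed
qed

section \<open>Parseval\<close>

text \<open>For \<open>t \<noteq> t'\<close> this is a geometric series whose ratio is an
  \<open>N\<close>-th root of unity other than \<open>1\<close>; the start \<open>K0\<close> only
  contributes a common factor.\<close>

lemma sum_exp_orthogonal:
  fixes K0 :: int
  assumes "N \<ge> 1" "t < N" "t' < N"
  shows "(\<Sum>j<N. exp (2 * of_real pi * \<i> * of_int (K0 + int j) * (of_nat t - of_nat t') / of_nat N))
           = (if t = t' then of_nat N else 0)"
proof (cases "t = t'")
  case False
  let ?w = "\<lambda>a::complex. exp (2 * of_real pi * \<i> * a / of_nat N)"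
  define q where "q = ?w (of_nat t - of_nat t')"
  \<comment> \<open>Written as a quotient, \<open>q \<noteq> 1\<close> follows from the distinctness
    of the \<open>N\<close>-th roots of unity with exponents below \<open>N\<close>.\<close>
  have "q = ?w (of_nat t) / ?w (of_nat t')"
    by (simp add: q_def exp_diff[symmetric] ring_distribs diff_divide_distrib)
  moreover have "?w (of_nat t) \<noteq> ?w (of_nat t')"
    using complex_root_unity_eq[OF assms(1), of t t'] False assms by simp
  ultimately have q1: "q \<noteq> 1" by auto
  have "q ^ N = ?w (of_nat N * of_nat t - of_nat N * of_nat t')"
    unfolding q_def by (simp flip: exp_of_nat_mult add: algebra_simps)
  also have "\<dots> = exp (2 * of_real pi * \<i> * of_nat t - 2 * of_real pi * \<i> * of_nat t')"
    using assms by (simp add: right_diff_distrib diff_divide_distrib mult.assoc)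
  also have "\<dots> = 1"
    using exp_integer_2pi[of "of_nat t"] exp_integer_2pi[of "of_nat t'"] by (simp add: exp_diff mult_ac)
  finally have qN: "q ^ N = 1" .
  have "(\<Sum>j<N. exp (2 * of_real pi * \<i> * of_int (K0 + int j) * (of_nat t - of_nat t') / of_nat N))
      = (\<Sum>j<N. ?w (of_int K0 * (of_nat t - of_nat t')) * q ^ j)"
    unfolding q_def
    by (intro sum.cong refl)
      (simp flip: exp_of_nat_mult exp_add add: algebra_simps diff_divide_distrib add_divide_distrib)
  also have "\<dots> = ?w (of_int K0 * (of_nat t - of_nat t')) * (\<Sum>j<N. q ^ j)"
    by (simp add: sum_distrib_left)
  also have "(\<Sum>j<N. q ^ j) = 0"
    using q1 qN by (simp add: geometric_sum)
  finally show ?thesis using False by simp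
qed simp

text \<open>The squared moduli are expanded into double sums over times; summing over a full period
  of frequencies first leaves only the diagonal, by orthogonality. The period may start
  anywhere.\<close>

lemma dft_parseval:
  fixes K0 :: int
  assumes "N \<ge> 1"
  shows "(\<Sum>j<N. (cmod (dft N x (K0 + int j)))\<^sup>2) = (\<Sum>t<N. (x t)\<^sup>2)"
proof -
  let ?e = "\<lambda>j t. exp (- 2 * of_real pi * \<i> * of_int (K0 + int j) * of_nat t / of_nat N)"
  have s: "complex_of_real (sqrt (real N)) * of_real (sqrt (real N)) = of_nat N"
    by (simp flip: of_real_mult)
  have "complex_of_real (\<Sum>j<N. (cmod (dft N x (K0 + int j)))\<^sup>2)
      = (\<Sum>j<N. dft N x (K0 + int j) * cnj (dft N x (K0 + int j)))"
    by (simp only: of_real_sum complex_norm_square)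
  also have "\<dots> = (\<Sum>j<N. \<Sum>t<N. \<Sum>t'<N. of_real (x t) * of_real (x t') / of_nat N *
      exp (2 * of_real pi * \<i> * of_int (K0 + int j) * (of_nat t' - of_nat t) / of_nat N))"
  proof (intro sum.cong refl)
    fix j
    have "cnj (?e j t') = exp (2 * of_real pi * \<i> * of_int (K0 + int j) * of_nat t' / of_nat N)" for t'
      by (simp add: exp_cnj)
    moreover have "exp (2 * of_real pi * \<i> * of_int (K0 + int j) * (of_nat t' - of_nat t) / of_nat N)
        = ?e j t * exp (2 * of_real pi * \<i> * of_int (K0 + int j) * of_nat t' / of_nat N)" for t t'
      unfolding exp_add[symmetric]
      by (rule arg_cong[where f = exp])
        (simp only: right_diff_distrib diff_divide_distrib mult_minus_left minus_divide_left[symmetric]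
          add.commute[of "- _"] diff_conv_add_uminus[symmetric])
    moreover have "a / of_real (sqrt (real N)) * of_real (x t) * (b / of_real (sqrt (real N)) * of_real (x t'))
        = of_real (x t) * of_real (x t') / of_nat N * (a * b)" for a b :: complex and t t'
      unfolding s[symmetric] by simp
    ultimately have "?e j t / of_real (sqrt (real N)) * of_real (x t) *
        (cnj (?e j t') / of_real (sqrt (real N)) * of_real (x t')) =
        of_real (x t) * of_real (x t') / of_nat N *
      exp (2 * of_real pi * \<i> * of_int (K0 + int j) * (of_nat t' - of_nat t) / of_nat N)" for t t'
      by simp
    then show "dft N x (K0 + int j) * cnj (dft N x (K0 + int j)) =
      (\<Sum>t<N. \<Sum>t'<N. of_real (x t) * of_real (x t') / of_nat N *
      exp (2 * of_real pi * \<i> * of_int (K0 + int j) * (of_nat t' - of_nat t) / of_nat N))"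
      unfolding dft_def cnj_sum sum_product by (intro sum.cong refl) simp
  qed
  also have "\<dots> = (\<Sum>t<N. \<Sum>t'<N. of_real (x t) * of_real (x t') / of_nat N *
      (\<Sum>j<N. exp (2 * of_real pi * \<i> * of_int (K0 + int j) * (of_nat t' - of_nat t) / of_nat N)))"
    unfolding sum_distrib_left by (subst sum.swap, rule sum.cong[OF refl], rule sum.swap)
  also have "\<dots> = (\<Sum>t<N. \<Sum>t'<N. if t' = t then of_real (x t) * of_real (x t') else 0)"
    using assms by (intro sum.cong refl) (subst sum_exp_orthogonal, auto)
  also have "\<dots> = of_real (\<Sum>t<N. (x t)\<^sup>2)"
    by (simp add: power2_eq_square)
  finally show ?thesis by (simp only: of_real_eq_iff)
qed

text \<open>The \<open>K\<close> frequencies are extended to a full period of \<open>N\<close>,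
  where Parseval applies.\<close>

lemma dft_on_norm_le:
  assumes "N \<ge> 1" "K \<le> N" "x \<in> vec_cball N 1"
  shows "L2_set (\<lambda>j. cmod (dft_on N K K0 x j)) {..<K} \<le> 1"
proof -
  have "(\<Sum>j<K. (cmod (dft_on N K K0 x j))\<^sup>2) = (\<Sum>j<K. (cmod (dft N x (K0 + int j)))\<^sup>2)"
    by (simp add: dft_on_def)
  also have "\<dots> \<le> (\<Sum>j<N. (cmod (dft N x (K0 + int j)))\<^sup>2)"
    using assms by (intro sum_mono2) auto
  also have "\<dots> = (\<Sum>t<N. (x t)\<^sup>2)" using assms by (intro dft_parseval)
  also have "\<dots> \<le> 1"
    using assms(3) by (simp add: vec_cball_def L2_set_def)
  finally show ?thesis by (simp add: L2_set_def)
qed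

section \<open>Measurability\<close>

text \<open>The inclusion of the vectors into \<open>nat \<Rightarrow> real\<close> with the product
  topology is Borel measurable since every coordinate is: a projection below \<open>N\<close>, the
  constant \<open>undefined\<close> from \<open>N\<close> on.\<close>

lemma measurable_of_continuous_on_vectors:
  assumes "X \<subseteq> {..<N} \<rightarrow>\<^sub>E UNIV" "space P = X"
    and sub: "sets (restrict_space (Pi\<^sub>M {..<N} (\<lambda>_. borel)) X) \<subseteq> sets P"
    and h: "continuous_on X (h :: (nat \<Rightarrow> real) \<Rightarrow> real)"
  shows "h \<in> borel_measurable P"
proof -
  let ?M = "Pi\<^sub>M {..<N} (\<lambda>_. borel :: real measure)"
  have "(\<lambda>x. x i) \<in> borel_measurable ?M" for i
  proof (cases "i < N")
    case False
    have "(\<lambda>x. x i) \<in> borel_measurable ?M \<longleftrightarrow> (\<lambda>x. undefined :: real) \<in> borel_measurable ?M"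
      using False by (intro measurable_cong) (auto simp: space_PiM PiE_def extensional_def)
    then show ?thesis by simp
  qed simp
  then have "(\<lambda>x. x) \<in> borel_measurable ?M"
    by (rule measurable_coordinatewise_then_product)
  then have "(\<lambda>x. x) \<in> measurable (restrict_space ?M X) (restrict_space borel X)"
    by (intro measurable_restrict_space2 measurable_restrict_space1) (auto simp: space_restrict_space)
  then have "h \<in> borel_measurable (restrict_space ?M X)"
    by (rule measurable_compose[OF _ borel_measurable_continuous_on_restrict[OF h]])
  moreover have "space (restrict_space ?M X) = space P"
    using assms(1,2) by (auto simp: space_restrict_space space_PiM)
  ultimately show ?thesis
    using sub by (auto simp: measurable_def)
qed

text \<open>\<open>g\<close> is Lipschitz only on \<open>S\<close> and for the distance of the first
  \<open>K\<close> entries, so the increment of the composite is dominated directly by a continuous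
  expression that vanishes at the base point.\<close>

lemma continuous_on_lipschitz_compose:
  fixes F :: "'a::topological_space \<Rightarrow> nat \<Rightarrow> complex"
  assumes "\<And>j. j < K \<Longrightarrow> continuous_on X (\<lambda>x. F x j)" and "\<And>x. x \<in> X \<Longrightarrow> F x \<in> S"
    and "\<forall>z\<in>S. \<forall>z'\<in>S. \<bar>g z - g z'\<bar> \<le> C * L2_set (\<lambda>i. norm (z i - z' i)) {..<K}"
  shows "continuous_on X (\<lambda>x. g (F x) :: real)"
  unfolding continuous_on_def
proof
  fix a assume a: "a \<in> X"
  have "((\<lambda>x. C * L2_set (\<lambda>i. norm (F x i - F a i)) {..<K}) \<longlongrightarrow>
      C * L2_set (\<lambda>i. norm (F a i - F a i)) {..<K}) (at a within X)"
    unfolding L2_set_def using assms(1) a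
    by (intro tendsto_intros) (auto simp: continuous_on_def)
  then have "((\<lambda>x. C * L2_set (\<lambda>i. norm (F x i - F a i)) {..<K}) \<longlongrightarrow> 0) (at a within X)"
    by (simp add: L2_set_def)
  then have "((\<lambda>x. g (F x) - g (F a)) \<longlongrightarrow> 0) (at a within X)"
    by (rule Lim_null_comparison[rotated])
      (use assms(2,3) a in \<open>auto simp: eventually_at_filter\<close>)
  then show "((\<lambda>x. g (F x)) \<longlongrightarrow> g (F a)) (at a within X)"
    by (simp add: Lim_null[of _ "g (F a)"])
qed

lemma continuous_on_fc_eval:
  assumes "\<And>i. continuous_on X (\<lambda>x. v x i)"
  shows "continuous_on X (\<lambda>x. fc_eval d \<Phi> (v x) i)"
  using assms
\<comment> \<open>The induction rule carries one input vector, the claim a family of them; the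
  member at the arbitrary point \<open>undefined\<close> takes the place of the vector, and the
  family is generalized.\<close>
proof (induction d \<Phi> "v undefined" arbitrary: v i rule: fc_eval.induct)
  case (3 d n W b l ls)
  have "continuous_on X (\<lambda>x. max (b i + (\<Sum>j<d. W i j * v x j)) 0)" for i
    by (intro continuous_intros "3.prems")
  from "3.hyps"[OF _ this] show ?case by simp
qed (auto intro!: continuous_intros)

lemma continuous_on_fc_map:
  assumes "\<And>j. continuous_on X (\<lambda>x. F x j)"
  shows "continuous_on X (\<lambda>x. fc_map K \<Phi> (F x))"
  unfolding fc_map_def
proof (rule continuous_on_fc_eval)
  show "continuous_on X (\<lambda>x. if even i then Re (F x (i div 2)) else Im (F x (i div 2)))" for i
    by (cases "even i") (auto intro!: continuous_intros assms)
qed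

section \<open>Truncated Taylor expansions\<close>

text \<open>The coefficient of \<open>v ^ k\<close> in \<open>(\<alpha> + \<beta> v) ^ s exp (\<gamma> v)\<close>.\<close>

definition tcoeff :: "real \<Rightarrow> real \<Rightarrow> complex \<Rightarrow> nat \<Rightarrow> nat \<Rightarrow> complex" where
  "tcoeff \<alpha> \<beta> \<gamma> s k =
     (\<Sum>m\<le>k. of_nat (s choose m) * of_real \<alpha> ^ (s - m) * of_real \<beta> ^ m * \<gamma> ^ (k - m) / fact (k - m))"

text \<open>After the shift \<open>s \<mapsto> s + m\<close> the binomial coefficient over
  \<open>fact (s + m)\<close> is \<open>1 / (fact m * fact s)\<close>, which leaves the exponential
  series of \<open>a * z\<close>.\<close>

lemma sums_shifted_exp:
  fixes z :: complex
  shows "(\<lambda>s. of_nat (s choose m) * a ^ (s - m) * z ^ s / fact s) sums (z ^ m / fact m * exp (a * z))"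
proof -
  have "(\<lambda>s. z ^ m / fact m * ((a * z) ^ s /\<^sub>R fact s)) sums (z ^ m / fact m * exp (a * z))"
    by (intro sums_mult exp_converges)
  also have "(\<lambda>s. z ^ m / fact m * ((a * z) ^ s /\<^sub>R fact s)) =
      (\<lambda>s. of_nat ((s + m) choose m) * a ^ (s + m - m) * z ^ (s + m) / fact (s + m))"
  proof
    fix s
    have "of_nat ((s + m) choose m) = (fact (s + m) / (fact m * fact s) :: complex)"
      using binomial_fact[of m "s + m", where 'a = complex] by simp
    then show "z ^ m / fact m * ((a * z) ^ s /\<^sub>R fact s) =
        of_nat ((s + m) choose m) * a ^ (s + m - m) * z ^ (s + m) / fact (s + m)"
      by (simp add: scaleR_conv_of_real power_mult_distrib power_add field_simps)
  qed
  finally show ?thesis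
    by (subst sums_zero_iff_shift[where n = m, symmetric]) (auto simp: binomial_eq_0)
qed

text \<open>Summing \<open>(\<alpha> + \<beta> v)^s exp (\<gamma> v) z^s / s!\<close> over
  \<open>s\<close> gives \<open>exp (\<alpha> z) exp ((\<beta> z + \<gamma>) v)\<close>; the
  right-hand side is its coefficient of \<open>v^k\<close>.\<close>

lemma tcoeff_sums:
  "(\<lambda>s. tcoeff \<alpha> \<beta> \<gamma> s k * z ^ s / fact s) sums (exp (of_real \<alpha> * z) * (of_real \<beta> * z + \<gamma>) ^ k / fact k)"
proof -
  have "(\<lambda>s. \<Sum>m\<le>k. of_real \<beta> ^ m * \<gamma> ^ (k - m) / fact (k - m) *
          (of_nat (s choose m) * of_real \<alpha> ^ (s - m) * z ^ s / fact s)) sums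
        (\<Sum>m\<le>k. of_real \<beta> ^ m * \<gamma> ^ (k - m) / fact (k - m) * (z ^ m / fact m * exp (of_real \<alpha> * z)))"
    by (intro sums_sum sums_mult sums_shifted_exp)
  also have "(\<lambda>s. \<Sum>m\<le>k. of_real \<beta> ^ m * \<gamma> ^ (k - m) / fact (k - m) *
          (of_nat (s choose m) * of_real \<alpha> ^ (s - m) * z ^ s / fact s)) =
      (\<lambda>s. tcoeff \<alpha> \<beta> \<gamma> s k * z ^ s / fact s)"
    unfolding tcoeff_def sum_distrib_right sum_divide_distrib
    by (intro ext sum.cong refl) (simp add: mult_ac)
  also have "(\<Sum>m\<le>k. of_real \<beta> ^ m * \<gamma> ^ (k - m) / fact (k - m) * (z ^ m / fact m * exp (of_real \<alpha> * z))) =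
      (\<Sum>m\<le>k. of_nat (k choose m) * (of_real \<beta> * z) ^ m * \<gamma> ^ (k - m)) * (exp (of_real \<alpha> * z) / fact k)"
    unfolding sum_distrib_right
    by (intro sum.cong refl) (simp add: binomial_fact power_mult_distrib field_simps)
  also have "\<dots> = exp (of_real \<alpha> * z) * (of_real \<beta> * z + \<gamma>) ^ k / fact k"
    by (simp add: binomial_ring)
  finally show ?thesis .
qed

text \<open>The sum of the moduli of the coefficients is submultiplicative under products of power
  series: it is \<open>(\<alpha> + \<beta>)^s \<le> 1\<close> for the polynomial factor and
  \<open>exp (norm \<gamma>)\<close> for the exponential one.\<close>

lemma sum_norm_tcoeff_le:
  assumes "0 \<le> \<alpha>" "0 \<le> \<beta>" "\<alpha> + \<beta> \<le> 1"
  shows "(\<Sum>k<r. norm (tcoeff \<alpha> \<beta> \<gamma> s k)) \<le> exp (norm \<gamma>)"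
proof -
  let ?b = "\<lambda>m. real (s choose m) * \<alpha> ^ (s - m) * \<beta> ^ m"
  let ?e = "\<lambda>k. norm \<gamma> ^ k / fact k"
  have pos: "?b m \<ge> 0" for m using assms by simp
  have b: "(\<Sum>m<r. ?b m) \<le> 1"
  proof -
    have "(\<Sum>m<r. ?b m) \<le> (\<Sum>m<r + Suc s. ?b m)"
      using assms by (intro sum_mono2) auto
    also have "\<dots> = (\<Sum>m\<le>s. ?b m)"
      by (intro sum.mono_neutral_right) (auto simp: binomial_eq_0)
    also have "\<dots> = (\<beta> + \<alpha>) ^ s"
      by (simp add: binomial_ring mult_ac)
    also have "\<dots> \<le> 1" using assms by (intro power_le_one) auto
    finally show ?thesis .
  qed
  have e: "(\<Sum>k<r. ?e k) \<le> exp (norm \<gamma>)" for r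
    using sum_le_suminf[of "\<lambda>k. norm \<gamma> ^ k /\<^sub>R fact k" "{..<r}"] summable_exp_generic[of "norm \<gamma>"]
    by (simp add: exp_def divide_inverse_commute)
  have "(\<Sum>k<r. norm (tcoeff \<alpha> \<beta> \<gamma> s k)) \<le> (\<Sum>k<r. \<Sum>m\<le>k. ?b m * ?e (k - m))"
    unfolding tcoeff_def
    by (intro sum_mono order.trans[OF norm_sum])
      (use assms in \<open>simp add: norm_mult norm_divide norm_power mult_ac\<close>)
  also have "\<dots> = (\<Sum>m<r. \<Sum>k<r - m. ?b m * ?e k)"
  proof -
    have "{(m, k). m + k < r} = (SIGMA m:{..<r}. {..<r - m})" by auto
    then show ?thesis
      using sum.triangle_reindex[of "\<lambda>m k. ?b m * ?e k" r] by (simp add: sum.Sigma)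
  qed
  also have "\<dots> = (\<Sum>m<r. ?b m * (\<Sum>k<r - m. ?e k))"
    by (simp add: sum_distrib_left)
  also have "\<dots> \<le> (\<Sum>m<r. ?b m * exp (norm \<gamma>))"
    by (intro sum_mono mult_left_mono e pos)
  also have "\<dots> = (\<Sum>m<r. ?b m) * exp (norm \<gamma>)"
    by (simp add: sum_distrib_right)
  also have "\<dots> \<le> 1 * exp (norm \<gamma>)" by (intro mult_right_mono b) simp
  finally show ?thesis by simp
qed

section \<open>Explicit constants and the tail of the exponential series\<close>

lemma exp_4_pi_le: "exp (4 * pi) \<le> 2 ^ 28" "exp pi \<le> 2 ^ 7"
proof -
  \<comment> \<open>\<open>pi < 4\<close> and \<open>exp 1 \<le> 3\<close> give \<open>81\<close>,
    which is rounded up to a power of two so that later bounds combine by adding exponents.\<close>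
  have "exp pi \<le> exp (real 4 * 1)" using pi_less_4 by simp
  also have "\<dots> = exp 1 ^ 4" by (rule exp_of_nat_mult)
  also have "\<dots> \<le> 3 ^ 4" by (intro power_mono exp_le) simp
  finally show *: "exp pi \<le> 2 ^ 7" by simp
  have "exp (4 * pi) = exp pi ^ 4" using exp_of_nat_mult[of 4 pi] by simp
  also have "\<dots> \<le> (2 ^ 7) ^ 4" by (intro power_mono *) simp
  finally show "exp (4 * pi) \<le> 2 ^ 28" by simp
qed

lemma exp_sums_divide:
  fixes x :: real
  shows "(\<lambda>s. x ^ s / fact s) sums exp x"
proof -
  have "(\<lambda>s. x ^ s /\<^sub>R fact s) = (\<lambda>s. x ^ s / fact s)"
    by (rule ext) (simp only: real_scaleR_def divide_inverse mult.commute)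
  then show ?thesis using exp_converges[of x] by simp
qed

text \<open>The tail of the series of \<open>exp (2 * pi)\<close>, where \<open>2 * pi\<close>
  bounds the phase variation over a pair of boxes. It measures the loss from keeping only
  \<open>r\<close> Taylor coefficients.\<close>

definition exp_tail :: "nat \<Rightarrow> real" where
  "exp_tail r = (\<Sum>s. (2 * pi) ^ (s + r) / fact (s + r))"

lemma summable_exp_tail: "summable (\<lambda>s. (2 * pi) ^ (s + r) / fact (s + r))"
  by (rule summable_ignore_initial_segment[OF sums_summable[OF exp_sums_divide]])

lemma exp_tail_nonneg: "exp_tail r \<ge> 0"
  unfolding exp_tail_def by (intro suminf_nonneg summable_exp_tail) auto

text \<open>For exponents \<open>m \<ge> r\<close> one has
  \<open>(2 * pi)^m \<le> (4 * pi)^m / 2^r\<close>: doubling the argument costs the constant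
  \<open>exp (4 * pi)\<close> and gains the factor \<open>2^r\<close>.\<close>

lemma exp_tail_le: "exp_tail r \<le> 2 ^ 28 / 2 ^ r"
proof -
  let ?f = "\<lambda>s. (4 * pi) ^ s / fact s"
  have f: "?f sums exp (4 * pi)" by (rule exp_sums_divide)
  have "exp_tail r \<le> (\<Sum>s. ?f (s + r) / 2 ^ r)"
    unfolding exp_tail_def
  proof (intro suminf_le summable_exp_tail)
    show "summable (\<lambda>s. ?f (s + r) / 2 ^ r)"
      using f by (intro summable_divide summable_ignore_initial_segment[where f = ?f]) (auto simp: sums_iff)
    fix s
    have "(2::real) ^ r \<le> 2 ^ (s + r)" by simp
    then have "(2 * pi) ^ (s + r) * 2 ^ r \<le> (2 * pi) ^ (s + r) * 2 ^ (s + r)"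
      by (intro mult_left_mono) auto
    also have "\<dots> = (2 * pi * 2) ^ (s + r)" by (rule power_mult_distrib[symmetric])
    also have "2 * pi * 2 = 4 * pi" by simp
    finally have "(2 * pi) ^ (s + r) \<le> (4 * pi) ^ (s + r) / 2 ^ r"
      by (subst pos_le_divide_eq) auto
    then have "(2 * pi) ^ (s + r) / fact (s + r) \<le> (4 * pi) ^ (s + r) / 2 ^ r / fact (s + r)"
      by (rule divide_right_mono) simp
    also have "\<dots> = ?f (s + r) / 2 ^ r"
      by (simp only: divide_divide_eq_left mult.commute)
    finally show "(2 * pi) ^ (s + r) / fact (s + r) \<le> ?f (s + r) / 2 ^ r" .
  qed
  also have "\<dots> = (\<Sum>s. ?f (s + r)) / 2 ^ r"
    using f by (intro suminf_divide summable_ignore_initial_segment[where f = ?f]) (auto simp: sums_iff)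
  also have "(\<Sum>s. ?f (s + r)) \<le> exp (4 * pi)"
    using suminf_split_initial_segment[of ?f r] f by (simp add: sums_iff sum_nonneg)
  also have "\<dots> \<le> 2 ^ 28" by (rule exp_4_pi_le)
  finally show ?thesis by (simp add: divide_right_mono)
qed

text \<open>The vector \<open>u\<close> approximates the first \<open>r\<close> Taylor coefficients of \<open>v \<mapsto> \<Sum>t. y t exp (z t v)\<close>; the
  layer substitutes \<open>\<alpha> + \<beta> v\<close> for \<open>v\<close> and multiplies by \<open>exp (\<gamma> v)\<close>.  Errors are measured in the
  \<open>\<ell>\<^sup>1\<close> norm of the coefficients, in which this operation has norm at most \<open>exp \<bar>\<gamma>\<bar>\<close>.\<close>

lemma transition_error:
  fixes y z :: "'a \<Rightarrow> complex" and u :: "nat \<Rightarrow> complex"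
  assumes "finite I" "\<And>t. t \<in> I \<Longrightarrow> norm (z t) \<le> 2 * pi"
    and "0 \<le> \<alpha>" "0 \<le> \<beta>" "\<alpha> + \<beta> \<le> 1" and "norm \<gamma> \<le> pi"
    and u: "(\<Sum>s<r. norm (u s - (\<Sum>t\<in>I. y t * z t ^ s / fact s))) \<le> \<eta> * (\<Sum>t\<in>I. norm (y t))"
  shows "(\<Sum>k<r. norm ((\<Sum>s<r. tcoeff \<alpha> \<beta> \<gamma> s k * u s)
            - (\<Sum>t\<in>I. y t * exp (of_real \<alpha> * z t) * (of_real \<beta> * z t + \<gamma>) ^ k / fact k)))
          \<le> 2 ^ 7 * (\<eta> + exp_tail r) * (\<Sum>t\<in>I. norm (y t))"
proof -
  let ?c = "tcoeff \<alpha> \<beta> \<gamma>"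
  let ?q = "\<lambda>s. \<Sum>t\<in>I. y t * z t ^ s / fact s"
  let ?g = "\<lambda>t k s. ?c (s + r) k * z t ^ (s + r) / fact (s + r)"
  have c: "(\<Sum>k<r. norm (?c s k)) \<le> 2 ^ 7" for s
  proof -
    have "(\<Sum>k<r. norm (?c s k)) \<le> exp (norm \<gamma>)"
      by (rule sum_norm_tcoeff_le) fact+
    also have "\<dots> \<le> exp pi" using assms by simp
    finally show ?thesis using exp_4_pi_le(2) by linarith
  qed
  have c1: "norm (?c s k) \<le> 2 ^ 7" if "k < r" for s k
    using c[of s] member_le_sum[of k "{..<r}" "\<lambda>k. norm (?c s k)"] that by force
  \<comment> \<open>The generating function cut at \<open>s = r\<close>: the finite part is what the
    layer makes of exact inputs, the series is the truncation error.\<close>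
  have exact: "exp (of_real \<alpha> * z t) * (of_real \<beta> * z t + \<gamma>) ^ k / fact k =
      (\<Sum>s<r. ?c s k * (z t ^ s / fact s)) + (\<Sum>s. ?g t k s)" for t k
    using suminf_split_initial_segment[OF sums_summable[OF tcoeff_sums[of \<alpha> \<beta> \<gamma> k "z t"]], of r]
      sums_unique[OF tcoeff_sums[of \<alpha> \<beta> \<gamma> k "z t"]] by simp
  have g_le: "norm (?g t k s) \<le> norm (?c (s + r) k) * ((2 * pi) ^ (s + r) / fact (s + r))"
    if "t \<in> I" for t k s
    using power_mono[OF assms(2)[OF that], of "s + r"]
    by (auto simp: norm_mult norm_divide norm_power intro!: divide_right_mono mult_left_mono)
  have g_summable: "summable (\<lambda>s. norm (?g t k s))" if "t \<in> I" "k < r" for t k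
  proof (rule summable_comparison_test')
    show "summable (\<lambda>s. 2 ^ 7 * ((2 * pi) ^ (s + r) / fact (s + r)))"
      by (intro summable_mult summable_exp_tail)
    show "norm (norm (?g t k s)) \<le> 2 ^ 7 * ((2 * pi) ^ (s + r) / fact (s + r))" for s
      using order.trans[OF g_le[OF that(1)] mult_right_mono[OF c1[OF that(2)]]] by simp
  qed
  have tail: "(\<Sum>k<r. norm (\<Sum>s. ?g t k s)) \<le> 2 ^ 7 * exp_tail r" if t: "t \<in> I" for t
  proof -
    have "(\<Sum>k<r. norm (\<Sum>s. ?g t k s)) \<le> (\<Sum>k<r. \<Sum>s. norm (?g t k s))"
      by (intro sum_mono summable_norm g_summable t) auto
    also have "\<dots> = (\<Sum>s. \<Sum>k<r. norm (?g t k s))"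
      by (intro suminf_sum[symmetric] g_summable t) auto
    also have "\<dots> \<le> (\<Sum>s. 2 ^ 7 * ((2 * pi) ^ (s + r) / fact (s + r)))"
    proof (intro suminf_le summable_mult summable_exp_tail summable_sum g_summable t)
      fix s
      have "(\<Sum>k<r. norm (?g t k s)) \<le> (\<Sum>k<r. norm (?c (s + r) k)) * ((2 * pi) ^ (s + r) / fact (s + r))"
        unfolding sum_distrib_right by (intro sum_mono g_le t)
      also have "\<dots> \<le> 2 ^ 7 * ((2 * pi) ^ (s + r) / fact (s + r))"
        by (intro mult_right_mono c) simp
      finally show "(\<Sum>k<r. norm (?g t k s)) \<le> 2 ^ 7 * ((2 * pi) ^ (s + r) / fact (s + r))" .
    qed auto
    also have "\<dots> = 2 ^ 7 * exp_tail r"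
      unfolding exp_tail_def by (intro suminf_mult summable_exp_tail)
    finally show ?thesis .
  qed
  \<comment> \<open>The output error is the image of the input error minus the truncation errors of
    the single terms.\<close>
  have split: "(\<Sum>s<r. ?c s k * u s) - (\<Sum>t\<in>I. y t * exp (of_real \<alpha> * z t) * (of_real \<beta> * z t + \<gamma>) ^ k / fact k)
      = (\<Sum>s<r. ?c s k * (u s - ?q s)) - (\<Sum>t\<in>I. y t * (\<Sum>s. ?g t k s))" for k
  proof -
    have "(\<Sum>t\<in>I. y t * exp (of_real \<alpha> * z t) * (of_real \<beta> * z t + \<gamma>) ^ k / fact k)
        = (\<Sum>t\<in>I. y t * (exp (of_real \<alpha> * z t) * (of_real \<beta> * z t + \<gamma>) ^ k / fact k))"
      by (simp add: mult.assoc)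
    also have "\<dots> = (\<Sum>t\<in>I. y t * (\<Sum>s<r. ?c s k * (z t ^ s / fact s))) + (\<Sum>t\<in>I. y t * (\<Sum>s. ?g t k s))"
      unfolding exact by (simp add: ring_distribs sum.distrib)
    also have "(\<Sum>t\<in>I. y t * (\<Sum>s<r. ?c s k * (z t ^ s / fact s))) = (\<Sum>s<r. ?c s k * ?q s)"
      unfolding sum_distrib_left by (subst sum.swap) (simp add: mult_ac)
    finally show ?thesis by (simp add: right_diff_distrib sum_subtractf)
  qed
  have "(\<Sum>k<r. norm ((\<Sum>s<r. ?c s k * u s)
            - (\<Sum>t\<in>I. y t * exp (of_real \<alpha> * z t) * (of_real \<beta> * z t + \<gamma>) ^ k / fact k)))
      \<le> (\<Sum>k<r. (\<Sum>s<r. norm (?c s k) * norm (u s - ?q s)) + (\<Sum>t\<in>I. norm (y t) * norm (\<Sum>s. ?g t k s)))"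
    unfolding split
    by (intro sum_mono order.trans[OF norm_triangle_ineq4] add_mono order.trans[OF norm_sum])
      (simp_all add: norm_mult)
  \<comment> \<open>With the sum over the output index \<open>k\<close> innermost, the column sums
    bounded in \<open>c\<close> and the tails bounded in \<open>tail\<close> appear.\<close>
  also have "\<dots> = (\<Sum>s<r. (\<Sum>k<r. norm (?c s k)) * norm (u s - ?q s)) + (\<Sum>t\<in>I. norm (y t) * (\<Sum>k<r. norm (\<Sum>s. ?g t k s)))"
    unfolding sum.distrib sum_distrib_left sum_distrib_right
    by (intro arg_cong2[where f = "(+)"]; rule sum.swap)
  also have "\<dots> \<le> (\<Sum>s<r. 2 ^ 7 * norm (u s - ?q s)) + (\<Sum>t\<in>I. norm (y t) * (2 ^ 7 * exp_tail r))"
    by (intro add_mono sum_mono mult_right_mono mult_left_mono c tail) auto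
  also have "\<dots> = 2 ^ 7 * (\<Sum>s<r. norm (u s - ?q s)) + 2 ^ 7 * exp_tail r * (\<Sum>t\<in>I. norm (y t))"
    by (simp add: sum_distrib_left sum_distrib_right mult_ac)
  also have "\<dots> \<le> 2 ^ 7 * (\<eta> * (\<Sum>t\<in>I. norm (y t))) + 2 ^ 7 * exp_tail r * (\<Sum>t\<in>I. norm (y t))"
    by (intro add_right_mono mult_left_mono u) auto
  finally show ?thesis by (simp add: algebra_simps)
qed

section \<open>Complex linear maps in ReLU layers\<close>

text \<open>The value before the ReLU: \<open>relu4\<close> turns it into
  \<open>cplx_enc z\<close>.\<close>

definition signed_enc :: "complex \<Rightarrow> real ^ 4" where
  "signed_enc z = vector [Re z, Im z, - Re z, - Im z]"

definition mult_mat :: "complex \<Rightarrow> real ^ 4 ^ 4" where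
  "mult_mat w = matrix (\<lambda>u. signed_enc (w * cplx_dec u))"

lemma vector_4_nth:
  "(vector [a, b, c, d] :: real ^ 4) $ 1 = a" "(vector [a, b, c, d] :: real ^ 4) $ 2 = b"
  "(vector [a, b, c, d] :: real ^ 4) $ 3 = c" "(vector [a, b, c, d] :: real ^ 4) $ 4 = d"
  by (simp_all add: vector_def)

lemma cplx_dec_relu4: "cplx_dec (relu4 (signed_enc z)) = z"
  by (simp add: cplx_dec_def relu4_def signed_enc_def vector_4_nth complex_eq_iff max_def)

lemma cplx_dec_enc: "cplx_dec (cplx_enc z) = z"
  by (simp add: cplx_dec_def cplx_enc_def vector_4_nth complex_eq_iff max_def min_def)

lemma linear_signed_enc: "linear signed_enc"
  by (rule linearI) (simp_all add: vec_eq_iff forall_4 signed_enc_def vector_4_nth)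

lemma linear_cplx_dec: "linear cplx_dec"
  by (rule linearI) (simp_all add: cplx_dec_def complex_eq_iff algebra_simps)

lemma mult_mat_mult: "mult_mat w *v u = signed_enc (w * cplx_dec u)"
proof -
  have "linear (\<lambda>u. signed_enc (w * cplx_dec u))"
    using linear_compose[OF linear_cplx_dec linear_compose[OF _ linear_signed_enc]]
    by (simp add: o_def linear_times)
  then show ?thesis by (simp add: mult_mat_def matrix_works linear_matrix_vector_mul_eq)
qed

text \<open>The sum of signed encodings is the signed encoding of the sum, and the ReLU keeps the
  positive parts of both a number and its negative, so decoding recovers the number.\<close>

lemma cplx_dec_layer:
  "cplx_dec (relu4 (\<Sum>i\<in>I. mult_mat (w i) *v u i)) = (\<Sum>i\<in>I. w i * cplx_dec (u i))"
  by (simp add: mult_mat_mult cplx_dec_relu4 flip: linear_sum[OF linear_signed_enc])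

lemma cplx_dec_layer2:
  "cplx_dec (relu4 (\<Sum>c\<in>J. \<Sum>i\<in>I. mult_mat (w c i) *v u c i)) = (\<Sum>c\<in>J. \<Sum>i\<in>I. w c i * cplx_dec (u c i))"
  by (simp add: mult_mat_mult cplx_dec_relu4 flip: linear_sum[OF linear_signed_enc])

section \<open>Error of one layer\<close>

text \<open>The exponent constant of the Fourier kernel of length \<open>2 ^ n\<close>: the kernel
  is \<open>exp (omega n * \<xi> * t)\<close> up to normalization.\<close>

definition omega :: "nat \<Rightarrow> complex" where
  "omega n = - 2 * of_real pi * \<i> / 2 ^ n"

lemma norm_omega: "norm (omega n) = 2 * pi / 2 ^ n"
  by (simp add: omega_def norm_mult norm_divide norm_power)

lemma norm_exp_omega: "norm (exp (omega n * of_real a)) = 1"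
proof -
  have "omega n * of_real a = \<i> * of_real (- 2 * pi / 2 ^ n * a)"
    by (simp add: omega_def)
  then show ?thesis by (simp only: norm_exp_i_times)
qed

lemma norm_omega_le:
  assumes "e + l \<le> n" "t \<le> 2 ^ l"
  shows "norm (omega n * 2 ^ e * of_nat t) \<le> 2 * pi"
proof -
  have t: "real t \<le> 2 ^ l"
    using assms(2) by (metis of_nat_le_iff of_nat_numeral of_nat_power)
  have "2 ^ e * real t \<le> 2 ^ e * 2 ^ l"
    by (rule mult_left_mono[OF t]) simp
  also have "\<dots> = 2 ^ (e + l)" by (rule power_add[symmetric])
  also have "\<dots> \<le> (2::real) ^ n"
    by (rule power_increasing[OF assms(1)]) simp
  finally have "2 ^ e * real t / 2 ^ n \<le> 1" by simp
  then have "2 * pi * (2 ^ e * real t / 2 ^ n) \<le> 2 * pi * 1"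
    by (rule mult_left_mono) simp
  moreover have "norm (omega n * 2 ^ e * of_nat t) = 2 * pi * (2 ^ e * real t / 2 ^ n)"
    by (simp add: norm_mult norm_omega norm_power)
  ultimately show ?thesis by simp
qed

text \<open>The exponential \<open>exp (\<omega> (\<xi> + 2 ^ e v) (\<tau> + t))\<close>, as a power series in the normalized frequency
  offset \<open>v\<close>, has the \<open>k\<close>-th coefficient below up to a factor which is independent of \<open>t\<close>.\<close>

definition taylor_sum ::
    "nat \<Rightarrow> (nat \<Rightarrow> real) \<Rightarrow> nat \<Rightarrow> nat \<Rightarrow> real \<Rightarrow> nat \<Rightarrow> nat \<Rightarrow> nat \<Rightarrow> complex" where
  "taylor_sum n x b h \<xi> \<tau> e k =
     (\<Sum>t<h. of_real (x (b + t)) * exp (omega n * of_real (\<xi> * real (\<tau> + t)))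
        * (omega n * 2 ^ e * of_nat t) ^ k / fact k)"

lemma sum_two_blocks:
  fixes h :: nat
  shows "(\<Sum>t<2 * h. F t) = (\<Sum>c<2. \<Sum>t<h. F (c * h + t))"
proof -
  have "(\<Sum>t<2 * h. F t) = (\<Sum>c<2. \<Sum>t\<in>{c * h..<c * h + h}. F t)"
    by (rule sum.nat_group[symmetric])
  also have "\<dots> = (\<Sum>c<2. \<Sum>t<h. F (c * h + t))"
  proof (rule sum.cong[OF refl])
    show "(\<Sum>t\<in>{c * h..<c * h + h}. F t) = (\<Sum>t<h. F (c * h + t))" for c
      using sum.atLeastLessThan_shift_bounds[of F 0 "c * h" h]
      by (simp add: lessThan_atLeast0 add.commute o_def)
  qed
  finally show ?thesis .
qed

text \<open>Each of the two child time boxes contributes a unimodular factor times an instance of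
  \<open>transition_error\<close>, and the sums of the moduli of the samples add up. Taking
  \<open>\<beta> = 1 / 2\<close> halves the frequency box, \<open>\<alpha> = 0\<close> with
  \<open>\<beta> = 1\<close> keeps it; the free start times \<open>\<tau>\<close> and
  \<open>\<tau>'\<close> cover relative as well as absolute times.\<close>

lemma layer_error:
  assumes \<alpha>\<beta>: "0 \<le> \<alpha>" "0 \<le> \<beta>" "\<alpha> + \<beta> \<le> 1"
    and \<xi>: "\<xi> = \<xi>' + \<alpha> * 2 ^ e'" and e: "2 ^ e = \<beta> * 2 ^ e'"
    and le: "e' + l \<le> n" "e + Suc l \<le> n"
    and child: "\<And>c. c < 2 \<Longrightarrow>
      (\<Sum>s<r. norm (u c s - taylor_sum n x (b + c * 2 ^ l) (2 ^ l) \<xi>' (\<tau>' c) e' s))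
        \<le> \<eta> * (\<Sum>t<2 ^ l. \<bar>x (b + c * 2 ^ l + t)\<bar>)"
  shows "(\<Sum>k<r. norm ((\<Sum>c<2. \<Sum>s<r.
        exp (omega n * of_real (\<xi> * real (\<tau> + c * 2 ^ l) - \<xi>' * real (\<tau>' c)))
          * tcoeff \<alpha> \<beta> (omega n * 2 ^ e * of_nat (c * 2 ^ l)) s k * u c s)
        - taylor_sum n x b (2 ^ Suc l) \<xi> \<tau> e k))
      \<le> 2 ^ 7 * (\<eta> + exp_tail r) * (\<Sum>t<2 ^ Suc l. \<bar>x (b + t)\<bar>)"
proof -
  define h :: nat where "h = 2 ^ l"
  define ph where "ph = (\<lambda>c. exp (omega n * of_real (\<xi> * real (\<tau> + c * h) - \<xi>' * real (\<tau>' c))))"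
  define \<gamma> where "\<gamma> = (\<lambda>c. omega n * 2 ^ e * of_nat (c * h))"
  define z where "z = (\<lambda>t. omega n * 2 ^ e' * of_nat t)"
  define y where "y = (\<lambda>c t. of_real (x (b + c * h + t)) * exp (omega n * of_real (\<xi>' * real (\<tau>' c + t))))"
  define v where "v = (\<lambda>c k. (\<Sum>s<r. tcoeff \<alpha> \<beta> (\<gamma> c) s k * u c s))"
  define q where "q = (\<lambda>c k. \<Sum>t<h. y c t * exp (of_real \<alpha> * z t) * (of_real \<beta> * z t + \<gamma> c) ^ k / fact k)"
  have norm_y: "norm (y c t) = \<bar>x (b + c * h + t)\<bar>" for c t
    by (simp only: y_def norm_mult norm_exp_omega norm_of_real mult_1_right)
  have e_cplx: "(2::complex) ^ e = of_real \<beta> * 2 ^ e'"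
  proof -
    have "complex_of_real (2 ^ e) = of_real (\<beta> * 2 ^ e')" by (simp only: e)
    then show ?thesis by simp
  qed
  \<comment> \<open>The bound \<open>2 * pi\<close> holds at the end \<open>2 * h\<close> of the
    merged box, hence \<open>pi\<close> at its midpoint \<open>h\<close>, where the second child
    starts.\<close>
  have \<gamma>_le: "norm (\<gamma> c) \<le> pi" if "c < 2" for c
  proof -
    have "norm (omega n * 2 ^ e * of_nat (2 * h)) \<le> 2 * pi"
      by (rule norm_omega_le[OF le(2)]) (simp add: h_def)
    then have "norm (omega n * 2 ^ e * of_nat h) \<le> pi"
      by (simp add: norm_mult norm_power)
    then show ?thesis
      using that by (auto simp: \<gamma>_def less_2_cases_iff)
  qed
  have main: "(\<Sum>k<r. norm (v c k - q c k)) \<le> 2 ^ 7 * (\<eta> + exp_tail r) * (\<Sum>t<h. norm (y c t))"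
    if c: "c < 2" for c
    unfolding v_def q_def
  proof (rule transition_error[OF _ _ \<alpha>\<beta> \<gamma>_le[OF c]])
    show "norm (z t) \<le> 2 * pi" if "t \<in> {..<h}" for t
      unfolding z_def using that by (intro norm_omega_le[OF le(1)]) (simp add: h_def)
    have "taylor_sum n x (b + c * h) h \<xi>' (\<tau>' c) e' s = (\<Sum>t<h. y c t * z t ^ s / fact s)" for s
      by (simp add: taylor_sum_def y_def z_def)
    then show "(\<Sum>s<r. norm (u c s - (\<Sum>t<h. y c t * z t ^ s / fact s))) \<le> \<eta> * (\<Sum>t<h. norm (y c t))"
      using child[OF c] by (simp add: h_def norm_y[unfolded h_def])
  qed simp
  \<comment> \<open>The phase at time \<open>\<tau> + c * h + t\<close> splits into
    \<open>ph c\<close>, the phase of the child and \<open>exp (\<alpha> * z t)\<close>, while the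
    time offset \<open>c * h + t\<close> scales to
    \<open>\<beta> * z t + \<gamma> c\<close>.\<close>
  have exact: "taylor_sum n x b (2 ^ Suc l) \<xi> \<tau> e k = (\<Sum>c<2. ph c * q c k)" for k
  proof -
    have "of_real (x (b + (c * h + t))) * exp (omega n * of_real (\<xi> * real (\<tau> + (c * h + t))))
        * (omega n * 2 ^ e * of_nat (c * h + t)) ^ k / fact k
      = ph c * (y c t * exp (of_real \<alpha> * z t) * (of_real \<beta> * z t + \<gamma> c) ^ k / fact k)" for c t
    proof -
      have "exp (omega n * of_real (\<xi> * real (\<tau> + (c * h + t))))
          = ph c * exp (omega n * of_real (\<xi>' * real (\<tau>' c + t))) * exp (of_real \<alpha> * z t)"
        unfolding ph_def z_def exp_add[symmetric] \<xi>
        by (rule arg_cong[where f = exp]) (simp add: algebra_simps)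
      moreover have "omega n * 2 ^ e * of_nat (c * h + t) = of_real \<beta> * z t + \<gamma> c"
        unfolding \<gamma>_def z_def e_cplx by (simp add: algebra_simps)
      ultimately show ?thesis by (simp add: y_def add.assoc)
    qed
    then show ?thesis
      unfolding taylor_sum_def power_Suc sum_two_blocks h_def[symmetric] q_def sum_distrib_left
      by (simp add: h_def)
  qed
  have "(\<Sum>c<2. \<Sum>s<r. ph c * tcoeff \<alpha> \<beta> (\<gamma> c) s k * u c s) - taylor_sum n x b (2 ^ Suc l) \<xi> \<tau> e k
      = (\<Sum>c<2. ph c * (v c k - q c k))" for k
    unfolding exact v_def by (simp add: sum_distrib_left right_diff_distrib sum_subtractf mult.assoc)
  then have "(\<Sum>k<r. norm ((\<Sum>c<2. \<Sum>s<r. ph c * tcoeff \<alpha> \<beta> (\<gamma> c) s k * u c s)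
        - taylor_sum n x b (2 ^ Suc l) \<xi> \<tau> e k)) = (\<Sum>k<r. norm (\<Sum>c<2. ph c * (v c k - q c k)))"
    by simp
  also have "\<dots> \<le> (\<Sum>k<r. \<Sum>c<2. norm (v c k - q c k))"
    by (intro sum_mono order.trans[OF norm_sum])
      (simp only: norm_mult ph_def norm_exp_omega mult_1_left order.refl)
  also have "\<dots> = (\<Sum>c<2. \<Sum>k<r. norm (v c k - q c k))" by (rule sum.swap)
  also have "\<dots> \<le> (\<Sum>c<2. 2 ^ 7 * (\<eta> + exp_tail r) * (\<Sum>t<h. norm (y c t)))"
    by (intro sum_mono main) simp
  also have "\<dots> = 2 ^ 7 * (\<eta> + exp_tail r) * (\<Sum>t<2 ^ Suc l. \<bar>x (b + t)\<bar>)"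
    unfolding power_Suc sum_two_blocks h_def[symmetric] norm_y
    by (simp add: sum_distrib_left add.assoc)
  finally show ?thesis by (simp add: ph_def \<gamma>_def h_def)
qed

section \<open>A Butterfly-net for the Fourier transform\<close>

text \<open>At level \<open>lev\<close> before the switch a frequency box consists of \<open>2 ^ log_width \<kappa> l lev\<close> frequencies.\<close>

definition log_width :: "nat \<Rightarrow> nat \<Rightarrow> nat \<Rightarrow> nat" where
  "log_width \<kappa> l lev = \<kappa> - min lev (\<kappa> - l)"

definition box_freq :: "int \<Rightarrow> nat \<Rightarrow> nat \<Rightarrow> real" where
  "box_freq K0 e i = of_int K0 + real i * 2 ^ e"

text \<open>Time and frequency boxes are represented by their left endpoints.  Before the switch times are
  relative to their box, so that the weights do not depend on the time box; the switch makes times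
  absolute, after which only the relative position \<open>i mod 2\<close> of the frequency box matters.\<close>

definition time_weight ::
    "nat \<Rightarrow> nat \<Rightarrow> int \<Rightarrow> nat \<Rightarrow> nat \<Rightarrow> nat \<Rightarrow> nat \<Rightarrow> nat \<Rightarrow> nat \<Rightarrow> complex" where
  "time_weight n \<kappa> K0 l lev i k c s =
     (let e = log_width \<kappa> l lev; t = c * 2 ^ (lev - 1) in
       exp (omega n * of_real (box_freq K0 e i * real t))
       * (if lev \<le> \<kappa> - l then tcoeff (real (i mod 2) / 2) (1 / 2) (omega n * 2 ^ e * of_nat t) s k
          else tcoeff 0 1 (omega n * 2 ^ e * of_nat t) s k))"

text \<open>The child and the corresponding half of the parent start at the same absolute time, so
  the base frequency cancels; what remains is the shift by \<open>a\<close> boxes of width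
  \<open>2 ^ (n - lev)\<close> times that start.\<close>

definition freq_weight ::
    "nat \<Rightarrow> nat \<Rightarrow> nat \<Rightarrow> nat \<Rightarrow> nat \<Rightarrow> nat \<Rightarrow> nat \<Rightarrow> complex" where
  "freq_weight n lev j a k c s =
     exp (omega n * of_real (real a * 2 ^ (n - lev) * real ((2 * j + c) * 2 ^ (lev - 1))))
     * tcoeff (real a / 2) (1 / 2) (omega n * 2 ^ (n - lev) * of_nat (c * 2 ^ (lev - 1))) s k"

text \<open>The depth is always \<open>n\<close>: each box of layer 0 is a single sample, and each output block is a
  single frequency.\<close>

definition dft_net :: "nat \<Rightarrow> nat \<Rightarrow> int \<Rightarrow> nat \<Rightarrow> nat \<Rightarrow> butterfly_net" where
  "dft_net n \<kappa> K0 r l = \<lparr>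
     Lt = n - l, Lxi = l, chan = r,
     W0 = (\<lambda>k q. mult_mat (if k = 0 then 1 else 0)), b0 = (\<lambda>k. 0),
     WT = (\<lambda>lev i k c s. mult_mat (time_weight n \<kappa> K0 l lev i k c s)), bT = (\<lambda>lev i k. 0),
     WS = (\<lambda>i j k s. mult_mat (if s = k
             then exp (omega n * of_real (box_freq K0 l i * real (j * 2 ^ (n - l)))) else 0)),
     bS = (\<lambda>i j k. 0),
     WX = (\<lambda>lev j a k c s. mult_mat (freq_weight n lev j a k c s)), bX = (\<lambda>lev j k. 0),
     WL = (\<lambda>q k. mult_mat (if k = 0 then 1 / of_real (sqrt (2 ^ n)) else 0)), bL = (\<lambda>q. 0)\<rparr>"

section \<open>Decoded values of the hidden layers\<close>

context
  fixes n \<kappa> l r :: nat and K0 :: int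
  assumes l: "l \<le> \<kappa>" and \<kappa>: "\<kappa> \<le> n" and r: "r \<ge> 1"
begin

private abbreviation (input) "B \<equiv> dft_net n \<kappa> K0 r l"

lemma dft_net_sel:
  "Lt B = n - l" "Lxi B = l" "chan B = r"
  "W0 B k q = mult_mat (if k = 0 then 1 else 0)" "b0 B k = 0"
  "WT B lev i k c s = mult_mat (time_weight n \<kappa> K0 l lev i k c s)" "bT B lev i k = 0"
  "WS B i j k s = mult_mat (if s = k
     then exp (omega n * of_real (box_freq K0 l i * real (j * 2 ^ (n - l)))) else 0)" "bS B i j k = 0"
  "WX B lev j a k c s = mult_mat (freq_weight n lev j a k c s)" "bX B lev j k = 0"
  "WL B q k = mult_mat (if k = 0 then 1 / of_real (sqrt (2 ^ n)) else 0)" "bL B q = 0"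
  by (simp_all add: dft_net_def)

lemma dft_net_shape:
  "depth B = n" "Lmin \<kappa> B = \<kappa> - l" "out_block \<kappa> B = 1" "bf_admissible n \<kappa> B"
proof -
  show d: "depth B = n" and m: "Lmin \<kappa> B = \<kappa> - l"
    using l \<kappa> by (simp_all add: depth_def Lmin_def dft_net_sel)
  have "nA \<kappa> B n = 2 ^ \<kappa>"
    unfolding nA_def m dft_net_sel using l \<kappa> by auto
  then show "out_block \<kappa> B = 1" by (simp add: out_block_def d)
  show "bf_admissible n \<kappa> B"
    using l \<kappa> r by (simp add: bf_admissible_def d dft_net_sel)
qed

lemma dec_lamT_0: "cplx_dec (lamT n \<kappa> B x 0 i j k) = (if k = 0 then of_real (x j) else 0)"
  using cplx_dec_layer[of "\<lambda>q. if k = 0 then 1 else 0" "\<lambda>q. cplx_enc (of_real (x (j * 2 ^ (n - depth B) + q)))"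
      "{..<2 ^ (n - depth B)}"]
  by (simp add: dft_net_sel dft_net_shape cplx_dec_enc)

lemma dec_lamT_Suc:
  "cplx_dec (lamT n \<kappa> B x (Suc lev) i j k) = (\<Sum>c<2. \<Sum>s<r. time_weight n \<kappa> K0 l (Suc lev) i k c s *
     cplx_dec (lamT n \<kappa> B x lev (if Suc lev \<le> \<kappa> - l then i div 2 else i) (2 * j + c) s))"
  using cplx_dec_layer2[where w = "time_weight n \<kappa> K0 l (Suc lev) i k"]
  by (simp add: dft_net_sel dft_net_shape)

lemma dec_lamS:
  assumes "k < r"
  shows "cplx_dec (lamS n \<kappa> B x i j k) =
    exp (omega n * of_real (box_freq K0 l i * real (j * 2 ^ (n - l)))) * cplx_dec (lamT n \<kappa> B x (n - l) i j k)"
  using assms unfolding lamS_def dft_net_sel add_0_left cplx_dec_layer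
  by (simp add: if_distrib[where f = "\<lambda>x. x * _"] cong: if_cong)

lemma dec_lamX_Suc:
  "cplx_dec (lamX n \<kappa> B x (Suc d) i j k) = (\<Sum>c<2. \<Sum>s<r. freq_weight n (n - l + Suc d) j (i mod 2) k c s *
     cplx_dec (lamX n \<kappa> B x d (i div 2) (2 * j + c) s))"
  unfolding lamX.simps dft_net_sel add_0_left cplx_dec_layer2 ..

text \<open>The last frequency boxes are single frequencies, so the constant coefficient in channel
  \<open>0\<close> stands for the Fourier sum there; the output weight supplies the unitary
  normalization.\<close>

lemma bf_map_dft_net:
  assumes "p < 2 ^ \<kappa>"
  shows "bf_map n \<kappa> B x p = cplx_dec (lamX n \<kappa> B x l p 0 0) / of_real (sqrt (2 ^ n))"
  using assms r unfolding bf_map_def dft_net_sel add_0_left cplx_dec_layer Let_def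
  by (simp add: dft_net_shape if_distrib[where f = "\<lambda>x. x * _"] cong: if_cong)

text \<open>The decoded values obey linear recursions, so continuity passes from layer to
  layer.\<close>

lemma continuous_on_bf_map: "continuous_on X (\<lambda>x. bf_map n \<kappa> B x p)"
proof (cases "p < 2 ^ \<kappa>")
  case True
  have coord: "continuous_on X (\<lambda>x. x j :: real)" for j :: nat
    by (rule continuous_on_subset[OF continuous_on_product_coordinates]) simp
  have T: "continuous_on X (\<lambda>x. cplx_dec (lamT n \<kappa> B x lev i j k))" for lev i j k
  proof (induction lev arbitrary: i j k)
    case 0
    show ?case by (cases "k = 0") (simp_all add: dec_lamT_0 coord continuous_on_of_real del: lamT.simps)
  next
    case (Suc lev)
    show ?case unfolding dec_lamT_Suc by (intro continuous_intros Suc)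
  qed
  have X: "continuous_on X (\<lambda>x. cplx_dec (lamX n \<kappa> B x d i j k))" if "k < r" for d i j k
    using that
  proof (induction d arbitrary: i j k)
    case 0
    then show ?case by (simp add: dec_lamS continuous_on_mult_left T)
  next
    case (Suc d)
    show ?case unfolding dec_lamX_Suc by (intro continuous_intros Suc.IH) simp
  qed
  have "continuous_on X (\<lambda>x. cplx_dec (lamX n \<kappa> B x l p 0 0) / of_real (sqrt (2 ^ n)))"
    using r by (intro continuous_intros X) auto
  then show ?thesis using True by (simp add: bf_map_dft_net)
next
  case False
  then show ?thesis by (simp add: bf_map_def)
qed

section \<open>Propagation of the error through the layers\<close>

lemma exp_tail_growth:
  "2 ^ 7 * ((2 ^ 8) ^ lev * exp_tail r + exp_tail r) \<le> (2 ^ 8) ^ Suc lev * exp_tail r"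
proof -
  \<comment> \<open>The fresh truncation error is at most the accumulated one, so the factor
    \<open>2 ^ 7\<close> at most doubles.\<close>
  have "exp_tail r \<le> (2 ^ 8) ^ lev * exp_tail r"
    using exp_tail_nonneg mult_right_mono[of 1 "(2 ^ 8) ^ lev" "exp_tail r"] by simp
  then show ?thesis by (simp add: mult.commute)
qed

text \<open>Induction over the layers before the switch, all start times being \<open>0\<close>
  since times are relative to their box.\<close>

lemma lamT_error:
  assumes "lev \<le> n - l"
  shows "(\<Sum>k<r. norm (cplx_dec (lamT n \<kappa> B x lev i j k)
           - taylor_sum n x (j * 2 ^ lev) (2 ^ lev) (box_freq K0 (log_width \<kappa> l lev) i) 0 (log_width \<kappa> l lev) k))
         \<le> (2 ^ 8) ^ lev * exp_tail r * (\<Sum>t<2 ^ lev. \<bar>x (j * 2 ^ lev + t)\<bar>)"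
  using assms
proof (induction lev arbitrary: i j)
  case 0
  \<comment> \<open>A box with the single time offset \<open>0\<close> has a constant Taylor series,
    so layer 0 is exact.\<close>
  have "cplx_dec (lamT n \<kappa> B x 0 i j k)
      = taylor_sum n x (j * 2 ^ 0) (2 ^ 0) (box_freq K0 (log_width \<kappa> l 0) i) 0 (log_width \<kappa> l 0) k" for k
    unfolding dec_lamT_0 by (cases k) (simp_all add: taylor_sum_def)
  then show ?case by (simp add: exp_tail_nonneg del: lamT.simps)
next
  case (Suc lev)
  define e e' where "e = log_width \<kappa> l (Suc lev)" and "e' = log_width \<kappa> l lev"
  define i' where "i' = (if Suc lev \<le> \<kappa> - l then i div 2 else i)"
  \<comment> \<open>In a refining layer the parity of \<open>i\<close> selects the half of the old
    frequency box; otherwise the substitution is the identity.\<close>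
  define \<alpha> \<beta> :: real where "\<alpha> = (if Suc lev \<le> \<kappa> - l then real (i mod 2) / 2 else 0)"
    and "\<beta> = (if Suc lev \<le> \<kappa> - l then 1 / 2 else 1)"
  define \<xi> \<xi>' where "\<xi> = box_freq K0 e i" and "\<xi>' = box_freq K0 e' i'"
  have \<alpha>\<beta>: "0 \<le> \<alpha>" "0 \<le> \<beta>" "\<alpha> + \<beta> \<le> 1"
    by (auto simp: \<alpha>_def \<beta>_def)
  have e: "(2::real) ^ e = \<beta> * 2 ^ e'"
  proof (cases "Suc lev \<le> \<kappa> - l")
    case True
    then have "e' = Suc e" by (auto simp: e_def e'_def log_width_def)
    then show ?thesis using True by (simp add: \<beta>_def)
  next
    case False
    then have "min (Suc lev) (\<kappa> - l) = min lev (\<kappa> - l)" by auto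
    then show ?thesis using False by (simp add: \<beta>_def e_def e'_def log_width_def)
  qed
  have \<xi>: "\<xi> = \<xi>' + \<alpha> * 2 ^ e'"
  proof (cases "Suc lev \<le> \<kappa> - l")
    case True
    have "real i = 2 * real (i div 2) + real (i mod 2)"
      by (metis div_mult_mod_eq mult.commute of_nat_add of_nat_mult of_nat_numeral)
    moreover have "(2::real) ^ e' = 2 * 2 ^ e" using True e by (simp add: \<beta>_def)
    ultimately show ?thesis
      using True by (simp add: \<xi>_def \<xi>'_def box_freq_def i'_def \<alpha>_def algebra_simps)
  next
    case False
    then show ?thesis using e by (simp add: \<xi>_def \<xi>'_def box_freq_def i'_def \<alpha>_def \<beta>_def)
  qed
  \<comment> \<open>While frequency boxes are halved, the two exponents add up to
    \<open>\<kappa>\<close>; afterwards the frequency exponent stays at \<open>l\<close>, and there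
    are \<open>n - l\<close> layers before the switch.\<close>
  have le: "e' + lev \<le> n" "e + Suc lev \<le> n"
    using Suc.prems l \<kappa> by (auto simp: e_def e'_def log_width_def min_def)
  have "(\<Sum>s<r. norm (cplx_dec (lamT n \<kappa> B x lev i' (2 * j + c) s)
          - taylor_sum n x (j * 2 ^ Suc lev + c * 2 ^ lev) (2 ^ lev) \<xi>' 0 e' s))
        \<le> (2 ^ 8) ^ lev * exp_tail r * (\<Sum>t<2 ^ lev. \<bar>x (j * 2 ^ Suc lev + c * 2 ^ lev + t)\<bar>)" for c
    using Suc.IH[of i' "2 * j + c"] Suc.prems
    by (simp add: e'_def \<xi>'_def algebra_simps)
  note err = layer_error[OF \<alpha>\<beta> \<xi> e le this, where \<tau> = 0]
  have "time_weight n \<kappa> K0 l (Suc lev) i k c s =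
      exp (omega n * of_real (\<xi> * real (0 + c * 2 ^ lev) - \<xi>' * real 0))
        * tcoeff \<alpha> \<beta> (omega n * 2 ^ e * of_nat (c * 2 ^ lev)) s k" for k c s
    by (simp add: time_weight_def Let_def \<xi>_def e_def \<alpha>_def \<beta>_def)
  then have "(\<Sum>k<r. norm (cplx_dec (lamT n \<kappa> B x (Suc lev) i j k)
           - taylor_sum n x (j * 2 ^ Suc lev) (2 ^ Suc lev) \<xi> 0 e k))
      \<le> 2 ^ 7 * ((2 ^ 8) ^ lev * exp_tail r + exp_tail r) * (\<Sum>t<2 ^ Suc lev. \<bar>x (j * 2 ^ Suc lev + t)\<bar>)"
    using err unfolding dec_lamT_Suc i'_def[symmetric] by simp
  also have "\<dots> \<le> (2 ^ 8) ^ Suc lev * exp_tail r * (\<Sum>t<2 ^ Suc lev. \<bar>x (j * 2 ^ Suc lev + t)\<bar>)"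
    by (intro mult_right_mono exp_tail_growth) (simp add: sum_nonneg)
  finally show ?case by (simp only: \<xi>_def e_def)
qed

text \<open>Each further layer halves the frequency box and doubles the time box, so the two
  exponents add up to \<open>n\<close> throughout. Times are now absolute.\<close>

lemma lamX_error:
  assumes "d \<le> l"
  shows "(\<Sum>k<r. norm (cplx_dec (lamX n \<kappa> B x d i j k)
           - taylor_sum n x (j * 2 ^ (n - l + d)) (2 ^ (n - l + d)) (box_freq K0 (l - d) i)
               (j * 2 ^ (n - l + d)) (l - d) k))
         \<le> (2 ^ 8) ^ (n - l + d) * exp_tail r * (\<Sum>t<2 ^ (n - l + d). \<bar>x (j * 2 ^ (n - l + d) + t)\<bar>)"
  using assms
proof (induction d arbitrary: i j)
  case 0
  let ?m = "n - l"
  let ?ph = "exp (omega n * of_real (box_freq K0 l i * real (j * 2 ^ ?m)))"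
  have w: "log_width \<kappa> l ?m = l"
    using l \<kappa> by (auto simp: log_width_def min_def)
  \<comment> \<open>The switch multiplies by the phase of the start of the time box. This factor is
    unimodular and leaves the error unchanged.\<close>
  have "taylor_sum n x (j * 2 ^ ?m) (2 ^ ?m) (box_freq K0 l i) (j * 2 ^ ?m) l k
      = ?ph * taylor_sum n x (j * 2 ^ ?m) (2 ^ ?m) (box_freq K0 l i) 0 l k" for k
    unfolding taylor_sum_def sum_distrib_left
    by (intro sum.cong refl) (simp add: exp_add ring_distribs)
  then have "norm (cplx_dec (lamX n \<kappa> B x 0 i j k)
        - taylor_sum n x (j * 2 ^ ?m) (2 ^ ?m) (box_freq K0 l i) (j * 2 ^ ?m) l k)
      = norm (cplx_dec (lamT n \<kappa> B x ?m i j k)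
        - taylor_sum n x (j * 2 ^ ?m) (2 ^ ?m) (box_freq K0 l i) 0 l k)" if "k < r" for k
    using that
    by (simp only: lamX.simps dec_lamS right_diff_distrib[symmetric] norm_mult norm_exp_omega mult_1_left)
  then show ?case
    using lamT_error[of ?m x i j] by (simp add: w)
next
  case (Suc d)
  define lev where "lev = n - l + d"
  define e where "e = l - Suc d"
  define \<alpha> where "\<alpha> = real (i mod 2) / 2"
  define \<xi> \<xi>' where "\<xi> = box_freq K0 e i" and "\<xi>' = box_freq K0 (Suc e) (i div 2)"
  have lev: "n - l + Suc d = Suc lev" "n - Suc lev = e" and e': "l - d = Suc e"
    using Suc.prems l \<kappa> by (auto simp: lev_def e_def)
  have \<alpha>: "0 \<le> \<alpha>" "0 \<le> (1 / 2 :: real)" "\<alpha> + 1 / 2 \<le> 1"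
    by (auto simp: \<alpha>_def)
  have "real i = 2 * real (i div 2) + real (i mod 2)"
    by (metis div_mult_mod_eq mult.commute of_nat_add of_nat_mult of_nat_numeral)
  then have \<xi>: "\<xi> = \<xi>' + \<alpha> * 2 ^ Suc e"
    by (simp add: \<xi>_def \<xi>'_def box_freq_def \<alpha>_def algebra_simps)
  have e: "(2::real) ^ e = 1 / 2 * 2 ^ Suc e" by simp
  have le: "Suc e + lev \<le> n" "e + Suc lev \<le> n"
    using Suc.prems l \<kappa> by (auto simp: lev_def e_def)
  have "(\<Sum>s<r. norm (cplx_dec (lamX n \<kappa> B x d (i div 2) (2 * j + c) s)
          - taylor_sum n x (j * 2 ^ Suc lev + c * 2 ^ lev) (2 ^ lev) \<xi>' ((2 * j + c) * 2 ^ lev) (Suc e) s))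
        \<le> (2 ^ 8) ^ lev * exp_tail r * (\<Sum>t<2 ^ lev. \<bar>x (j * 2 ^ Suc lev + c * 2 ^ lev + t)\<bar>)" for c
  proof -
    have "j * 2 ^ Suc lev + c * 2 ^ lev = (2 * j + c) * 2 ^ lev" by (simp add: algebra_simps)
    then show ?thesis
      using Suc.IH[of "i div 2" "2 * j + c"] Suc.prems unfolding e' lev_def[symmetric] \<xi>'_def by simp
  qed
  note err = layer_error[OF \<alpha> \<xi> e le this, where \<tau> = "j * 2 ^ Suc lev"]
  have "freq_weight n (Suc lev) j (i mod 2) k c s =
      exp (omega n * of_real (\<xi> * real (j * 2 ^ Suc lev + c * 2 ^ lev) - \<xi>' * real ((2 * j + c) * 2 ^ lev)))
        * tcoeff \<alpha> (1 / 2) (omega n * 2 ^ e * of_nat (c * 2 ^ lev)) s k" for k c s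
  proof -
    \<comment> \<open>Both start times agree, so only
      \<open>\<xi> - \<xi>' = (i mod 2) * 2 ^ e\<close> survives.\<close>
    have "\<xi> * real (j * 2 ^ Suc lev + c * 2 ^ lev) - \<xi>' * real ((2 * j + c) * 2 ^ lev)
        = real (i mod 2) * 2 ^ e * real ((2 * j + c) * 2 ^ lev)"
      unfolding \<xi> \<alpha>_def by (simp add: algebra_simps)
    then show ?thesis
      by (simp only: freq_weight_def lev \<alpha>_def diff_Suc_1)
  qed
  then have "(\<Sum>k<r. norm (cplx_dec (lamX n \<kappa> B x (Suc d) i j k)
           - taylor_sum n x (j * 2 ^ Suc lev) (2 ^ Suc lev) \<xi> (j * 2 ^ Suc lev) e k))
      \<le> 2 ^ 7 * ((2 ^ 8) ^ lev * exp_tail r + exp_tail r) * (\<Sum>t<2 ^ Suc lev. \<bar>x (j * 2 ^ Suc lev + t)\<bar>)"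
    using err unfolding dec_lamX_Suc lev by simp
  also have "\<dots> \<le> (2 ^ 8) ^ Suc lev * exp_tail r * (\<Sum>t<2 ^ Suc lev. \<bar>x (j * 2 ^ Suc lev + t)\<bar>)"
    by (intro mult_right_mono exp_tail_growth) (simp add: sum_nonneg)
  finally show ?case by (simp only: lev \<xi>_def e_def)
qed

text \<open>The exponent \<open>10 * n + 28\<close> collects \<open>8 * n\<close> from the layers,
  \<open>n\<close> from the sum of the moduli of the samples, \<open>28\<close> from
  \<open>exp_tail_le\<close> and \<open>n\<close> from adding the errors of all outputs.\<close>

lemma bf_map_error:
  assumes "x \<in> vec_cball (2 ^ n) 1"
  shows "L2_set (\<lambda>p. norm (dft_on (2 ^ n) (2 ^ \<kappa>) K0 x p - bf_map n \<kappa> B x p)) {..<2 ^ \<kappa>}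
    \<le> 2 ^ (10 * n + 28) / 2 ^ r"
proof -
  have x_le: "\<bar>x t\<bar> \<le> 1" if "t < 2 ^ n" for t
    using assms that member_le_L2_set[of "{..<2 ^ n}" t "\<lambda>i. norm (x i)"]
    by (simp add: vec_cball_def)
  have "(\<Sum>t<2 ^ n. \<bar>x t\<bar>) \<le> (\<Sum>t<(2::nat) ^ n. 1)"
    by (intro sum_mono x_le) simp
  then have x_sum: "(\<Sum>t<2 ^ n. \<bar>x t\<bar>) \<le> 2 ^ n" by simp
  have sqrt1: "sqrt (2 ^ n) \<ge> 1" by simp
  have err: "norm (dft_on (2 ^ n) (2 ^ \<kappa>) K0 x p - bf_map n \<kappa> B x p) \<le> 2 ^ (9 * n + 28) / 2 ^ r"
    if p: "p < 2 ^ \<kappa>" for p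
  proof -
    let ?T = "taylor_sum n x 0 (2 ^ n) (box_freq K0 0 p) 0 0"
    have "dft_on (2 ^ n) (2 ^ \<kappa>) K0 x p = ?T 0 / of_real (sqrt (2 ^ n))"
      using p
      by (simp add: dft_on_def dft_def taylor_sum_def sum_divide_distrib omega_def box_freq_def mult_ac)
    then have "norm (dft_on (2 ^ n) (2 ^ \<kappa>) K0 x p - bf_map n \<kappa> B x p)
        = norm (cplx_dec (lamX n \<kappa> B x l p 0 0) - ?T 0) / sqrt (2 ^ n)"
      using p by (simp add: bf_map_dft_net norm_divide norm_minus_commute flip: diff_divide_distrib)
    also have "\<dots> \<le> norm (cplx_dec (lamX n \<kappa> B x l p 0 0) - ?T 0)"
      using sqrt1 divide_left_mono[of 1 "sqrt (2 ^ n)" "norm (cplx_dec (lamX n \<kappa> B x l p 0 0) - ?T 0)"] by simp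
    also have "\<dots> \<le> (\<Sum>k<r. norm (cplx_dec (lamX n \<kappa> B x l p 0 k) - ?T k))"
      using r by (intro member_le_sum[where f = "\<lambda>k. norm (cplx_dec (lamX n \<kappa> B x l p 0 k) - ?T k)"]) auto
    also have "\<dots> \<le> (2 ^ 8) ^ n * exp_tail r * (\<Sum>t<2 ^ n. \<bar>x t\<bar>)"
      using lamX_error[of l x p 0] l \<kappa> by simp
    also have "\<dots> \<le> (2 ^ 8) ^ n * (2 ^ 28 / 2 ^ r) * 2 ^ n"
      by (intro mult_mono x_sum mult_left_mono exp_tail_le) (auto simp: exp_tail_nonneg sum_nonneg)
    also have "\<dots> = 2 ^ (9 * n + 28) / 2 ^ r"
      by (simp add: power_add power_mult flip: power_mult_distrib)
    finally show ?thesis .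
  qed
  have "L2_set (\<lambda>p. norm (dft_on (2 ^ n) (2 ^ \<kappa>) K0 x p - bf_map n \<kappa> B x p)) {..<2 ^ \<kappa>}
      \<le> (\<Sum>p<2 ^ \<kappa>. norm (dft_on (2 ^ n) (2 ^ \<kappa>) K0 x p - bf_map n \<kappa> B x p))"
    by (rule L2_set_le_sum) simp
  also have "\<dots> \<le> (\<Sum>p<(2::nat) ^ \<kappa>. 2 ^ (9 * n + 28) / 2 ^ r)"
    by (intro sum_mono err) simp
  also have "\<dots> = 2 ^ \<kappa> * (2 ^ (9 * n + 28) / 2 ^ r)" by simp
  also have "\<dots> \<le> 2 ^ n * (2 ^ (9 * n + 28) / 2 ^ r)"
    using \<kappa> by (intro mult_right_mono power_increasing) auto
  also have "\<dots> = 2 ^ (10 * n + 28) / 2 ^ r"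
    by (simp flip: power_add)
  finally show ?thesis .
qed

section \<open>Number of parameters\<close>

lemma bf_params_dft_net_le:
  assumes "n \<ge> 1"
  shows "bf_params n \<kappa> B \<le> 200 * (n * 2 ^ \<kappa> * r\<^sup>2)"
proof -
  \<comment> \<open>Every layer has at most \<open>2 ^ \<kappa>\<close> groups of parameters, of
    size \<open>O(r^2)\<close> each, and either side of the switch has at most \<open>n\<close>
    layers.\<close>
  let ?A = "n * 2 ^ \<kappa> * r\<^sup>2"
  have rr: "r \<le> r\<^sup>2" using r by (simp add: power2_eq_square)
  have "1 * 1 \<le> n * 2 ^ \<kappa>" using assms by (intro mult_le_mono) auto
  then have A: "r\<^sup>2 \<le> ?A" by simp
  have nAT: "nA \<kappa> B lev \<le> 2 ^ (\<kappa> - l)" if "lev \<le> n - l" for lev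
    using that by (auto simp: nA_def dft_net_shape dft_net_sel intro: power_increasing)
  have T: "(\<Sum>lev=1..n - l. nA \<kappa> B lev * (4 * r + 16 * (r * 2 * r))) \<le> 36 * ?A"
  proof -
    have "(\<Sum>lev=1..n - l. nA \<kappa> B lev * (4 * r + 16 * (r * 2 * r))) \<le> (\<Sum>lev=1..n - l. 2 ^ \<kappa> * (36 * r\<^sup>2))"
    proof (intro sum_mono mult_le_mono)
      fix lev assume "lev \<in> {1..n - l}"
      then have "nA \<kappa> B lev \<le> 2 ^ (\<kappa> - l)" by (intro nAT) simp
      also have "\<dots> \<le> 2 ^ \<kappa>" by (intro power_increasing) auto
      finally show "nA \<kappa> B lev \<le> 2 ^ \<kappa>" .
      show "4 * r + 16 * (r * 2 * r) \<le> 36 * r\<^sup>2" using rr by (simp add: power2_eq_square)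
    qed
    also have "\<dots> \<le> n * (2 ^ \<kappa> * (36 * r\<^sup>2))" by simp
    finally show ?thesis by (simp add: mult_ac)
  qed
  have S: "nA \<kappa> B (n - l) * 2 ^ l * (4 * r + 16 * (r * r)) \<le> 20 * ?A"
  proof -
    have "nA \<kappa> B (n - l) * 2 ^ l * (4 * r + 16 * (r * r)) \<le> 2 ^ (\<kappa> - l) * 2 ^ l * (20 * r\<^sup>2)"
      using rr by (intro mult_le_mono nAT) (auto simp: power2_eq_square)
    also have "2 ^ (\<kappa> - l) * 2 ^ l = (2::nat) ^ \<kappa>" using l by (simp flip: power_add)
    also have "2 ^ \<kappa> * (20 * r\<^sup>2) \<le> n * (2 ^ \<kappa> * (20 * r\<^sup>2))" using assms by simp
    finally show ?thesis by (simp add: mult_ac)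
  qed
  have X: "(\<Sum>lev=n - l + 1..n. 2 ^ (n - lev) * (4 * r + 16 * (2 * r * 2 * r))) \<le> 68 * ?A"
  proof -
    have "(\<Sum>lev=n - l + 1..n. 2 ^ (n - lev) * (4 * r + 16 * (2 * r * 2 * r))) \<le> (\<Sum>lev=n - l + 1..n. 2 ^ \<kappa> * (68 * r\<^sup>2))"
    proof (intro sum_mono mult_le_mono)
      fix lev assume "lev \<in> {n - l + 1..n}"
      then show "(2::nat) ^ (n - lev) \<le> 2 ^ \<kappa>" using l by (intro power_increasing) auto
      show "4 * r + 16 * (2 * r * 2 * r) \<le> 68 * r\<^sup>2" using rr by (simp add: power2_eq_square)
    qed
    also have "\<dots> \<le> n * (2 ^ \<kappa> * (68 * r\<^sup>2))" by simp
    finally show ?thesis by (simp add: mult_ac)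
  qed
  have "bf_params n \<kappa> B = (4 * r + 16 * r)
     + (\<Sum>lev=1..n - l. nA \<kappa> B lev * (4 * r + 16 * (r * 2 * r)))
     + nA \<kappa> B (n - l) * 2 ^ l * (4 * r + 16 * (r * r))
     + (\<Sum>lev=n - l + 1..n. 2 ^ (n - lev) * (4 * r + 16 * (2 * r * 2 * r)))
     + (4 + 16 * r)"
    using l \<kappa> by (simp add: bf_params_def Let_def dft_net_shape dft_net_sel)
  \<comment> \<open>The coefficients add up to \<open>164\<close>, which is rounded up to
    \<open>200\<close>.\<close>
  also have "\<dots> \<le> 20 * r\<^sup>2 + 36 * ?A + 20 * ?A + 68 * ?A + 20 * r\<^sup>2"
    using T S X rr r by linarith
  also have "\<dots> \<le> 200 * ?A" using A by linarith
  finally show ?thesis .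
qed

end

section \<open>Approximation of the functional\<close>

text \<open>The error splits at \<open>g\<close> of the exact and of the computed Fourier vector:
  \<open>\<epsilon>\<close> in the \<open>L^p\<close> norm by assumption,
  \<open>C2 * \<epsilon>\<close> by the Lipschitz bound and \<open>\<epsilon>\<close> from the
  fully-connected net. The exact vector has norm at most \<open>1\<close>, so the computed one stays
  in the ball of radius \<open>11 / 10\<close>, where both bounds are available.\<close>

lemma Lp_norm_dft_net_le:
  fixes N K n \<kappa> l :: nat and \<epsilon> C2 :: real
  assumes N: "N = 2 ^ n" and K: "K = 2 ^ \<kappa>" and \<kappa>: "\<kappa> \<le> n" and l: "l \<le> \<kappa>" and r: "r \<ge> 1"
    and X: "X \<subseteq> vec_cball N 1" and P: "prob_space P" "space P = X"
      "sets (restrict_space (Pi\<^sub>M {..<N} (\<lambda>_. borel)) X) \<subseteq> sets P"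
    and "p \<ge> 1" "C2 > 0" "0 < \<epsilon>" "\<epsilon> < 1 / 10"
    and lip: "\<forall>z\<in>vec_cball K (11 / 10). \<forall>z'\<in>vec_cball K (11 / 10).
       \<bar>g z - g z'\<bar> \<le> C2 * L2_set (\<lambda>i. norm (z i - z' i)) {..<K}"
    and \<Phi>: "\<And>z. z \<in> vec_cball K (11 / 10) \<Longrightarrow> \<bar>fc_map K \<Phi> z - g z\<bar> \<le> \<epsilon>"
    and fg: "Lp_norm P p (\<lambda>x. f x - g (dft_on N K K0 x)) \<le> ennreal \<epsilon>"
    and small: "2 ^ (10 * n + 28) / 2 ^ r \<le> \<epsilon>"
  shows "(\<forall>x\<in>X. bf_map n \<kappa> (dft_net n \<kappa> K0 r l) x \<in> vec_cball K (11 / 10)) \<and>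
    Lp_norm P p (\<lambda>x. f x - fc_map K \<Phi> (bf_map n \<kappa> (dft_net n \<kappa> K0 r l) x)) \<le> ennreal (\<epsilon> * (2 + C2))"
proof
  let ?B = "bf_map n \<kappa> (dft_net n \<kappa> K0 r l)"
  have KN: "K \<le> N" "N \<ge> 1" using \<kappa> by (simp_all add: K N)
  have dist: "L2_set (\<lambda>j. norm (dft_on N K K0 x j - ?B x j)) {..<K} \<le> \<epsilon>" if "x \<in> X" for x
    using bf_map_error[OF l \<kappa> r, of x K0] small that X unfolding N K by fastforce
  have dft_le: "L2_set (\<lambda>j. norm (dft_on N K K0 x j)) {..<K} \<le> 1" if "x \<in> X" for x
    using dft_on_norm_le[OF KN(2,1), of x] that X by auto
  have dft_ball: "dft_on N K K0 x \<in> vec_cball K (11 / 10)" if "x \<in> X" for x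
    using dft_le[OF that] by (simp add: vec_cball_def dft_on_def)
  show B_ball': "\<forall>x\<in>X. ?B x \<in> vec_cball K (11 / 10)"
  proof
    fix x assume x: "x \<in> X"
    have "L2_set (\<lambda>j. norm (?B x j)) {..<K}
        \<le> L2_set (\<lambda>j. norm (dft_on N K K0 x j) + norm (dft_on N K K0 x j - ?B x j)) {..<K}"
      by (intro L2_set_mono norm_ge_zero) (metis norm_minus_commute norm_triangle_sub)
    also have "\<dots> \<le> L2_set (\<lambda>j. norm (dft_on N K K0 x j)) {..<K}
        + L2_set (\<lambda>j. norm (dft_on N K K0 x j - ?B x j)) {..<K}"
      by (rule L2_set_triangle_ineq)
    also have "\<dots> \<le> 11 / 10" using dft_le[OF x] dist[OF x] \<open>\<epsilon> < 1 / 10\<close> by simp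
    finally show "?B x \<in> vec_cball K (11 / 10)"
      by (simp add: vec_cball_def bf_map_def K)
  qed
  then have B_ball: "?B x \<in> vec_cball K (11 / 10)" if "x \<in> X" for x using that by blast
  have meas: "h \<in> borel_measurable P" if "continuous_on X h" for h :: "(nat \<Rightarrow> real) \<Rightarrow> real"
    using X that by (intro measurable_of_continuous_on_vectors[OF _ P(2,3)]) (auto simp: vec_cball_def)
  have coord: "continuous_on X (\<lambda>x. x j :: real)" for j :: nat
    by (rule continuous_on_subset[OF continuous_on_product_coordinates]) simp
  have dft_cont: "continuous_on X (\<lambda>x. dft_on N K K0 x j)" if "j < K" for j
    using that KN by (auto simp: dft_on_def dft_def intro!: continuous_intros coord)
  have "continuous_on X (\<lambda>x. g (dft_on N K K0 x))"
    by (rule continuous_on_lipschitz_compose[OF dft_cont dft_ball lip])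
  moreover have "continuous_on X (\<lambda>x. fc_map K \<Phi> (?B x))"
    by (intro continuous_on_fc_map continuous_on_bf_map l \<kappa> r)
  ultimately have m: "(\<lambda>x. g (dft_on N K K0 x)) \<in> borel_measurable P"
      "(\<lambda>x. fc_map K \<Phi> (?B x)) \<in> borel_measurable P"
    by (auto intro: meas)
  \<comment> \<open>A finite \<open>Lp_norm\<close> entails measurability; adding and subtracting
    continuous functions of \<open>x\<close> carries it over to the new difference.\<close>
  have "(\<lambda>x. f x - g (dft_on N K K0 x)) \<in> borel_measurable P"
    using fg by (auto simp: Lp_norm_def top_unique split: if_splits)
  from borel_measurable_diff[OF borel_measurable_add[OF this m(1)] m(2)]
  have meas_diff: "(\<lambda>x. f x - fc_map K \<Phi> (?B x)) \<in> borel_measurable P" by simp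
  have "\<bar>f x - fc_map K \<Phi> (?B x)\<bar> \<le> \<bar>f x - g (dft_on N K K0 x)\<bar> + (\<epsilon> + C2 * \<epsilon>)" if "x \<in> space P" for x
  proof -
    have x: "x \<in> X" using that P by simp
    have "\<bar>g (dft_on N K K0 x) - g (?B x)\<bar> \<le> C2 * L2_set (\<lambda>i. norm (dft_on N K K0 x i - ?B x i)) {..<K}"
      using lip dft_ball[OF x] B_ball[OF x] by blast
    also have "\<dots> \<le> C2 * \<epsilon>"
      using dist[OF x] \<open>C2 > 0\<close> by (intro mult_left_mono) auto
    finally show ?thesis using \<Phi>[OF B_ball[OF x]] by linarith
  qed
  moreover have "\<epsilon> + C2 * \<epsilon> > 0" using \<open>C2 > 0\<close> \<open>0 < \<epsilon>\<close> by (simp add: add_pos_pos)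
  ultimately have "Lp_norm P p (\<lambda>x. f x - fc_map K \<Phi> (?B x)) \<le> ennreal (\<epsilon> + (\<epsilon> + C2 * \<epsilon>))"
    using \<open>p \<ge> 1\<close> \<open>0 < \<epsilon>\<close> fg meas_diff by (intro Lp_norm_perturb[OF P(1)])
  then show "Lp_norm P p (\<lambda>x. f x - fc_map K \<Phi> (?B x)) \<le> ennreal (\<epsilon> * (2 + C2))"
    by (simp add: algebra_simps)
qed

section \<open>Choice of the number of channels\<close>

lemma channel_count:
  fixes \<epsilon> :: real and n :: nat
  assumes "0 < \<epsilon>" "\<epsilon> < 1" "n \<ge> 1"
  defines "r \<equiv> nat \<lceil>log 2 (1 / \<epsilon>)\<rceil> + 10 * n + 28"
  shows "2 ^ (10 * n + 28) / 2 ^ r \<le> \<epsilon>" and "real r \<le> 39 * (log 2 (1 / \<epsilon>) + real n)"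
proof -
  let ?a = "log 2 (1 / \<epsilon>)"
  have a: "?a > 0" using assms by simp
  have "1 / \<epsilon> = 2 powr ?a" using assms by simp
  also have "\<dots> \<le> 2 powr real (nat \<lceil>?a\<rceil>)"
    by (intro powr_mono) (use a in linarith, simp)
  also have "\<dots> = 2 ^ nat \<lceil>?a\<rceil>" by (simp add: powr_realpow)
  finally have "1 / 2 ^ nat \<lceil>?a\<rceil> \<le> \<epsilon>" using assms by (simp add: field_simps)
  moreover have "(2::real) ^ (10 * n + 28) / 2 ^ r = 1 / 2 ^ nat \<lceil>?a\<rceil>"
    by (simp add: r_def power_add)
  ultimately show "2 ^ (10 * n + 28) / 2 ^ r \<le> \<epsilon>" by simp
  have "real (nat \<lceil>?a\<rceil>) \<le> ?a + 1" using a by linarith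
  moreover have "real r = real (nat \<lceil>?a\<rceil>) + 10 * real n + 28"
    by (simp add: r_def)
  moreover have "real n \<ge> 1" using assms(3) by simp
  \<comment> \<open>The constant is \<open>39 = 10 + 28 + 1\<close>, where \<open>n \<ge> 1\<close>
    absorbs the \<open>28\<close> and the \<open>1\<close> lost by rounding up.\<close>
  ultimately show "real r \<le> 39 * (?a + real n)" using a by argo
qed

theorem mainTheorem1:
  shows "\<exists>C::real. \<forall>(N::nat) (K::nat) (n::nat) (\<kappa>::nat)
      (X :: (nat \<Rightarrow> real) set) (P :: (nat \<Rightarrow> real) measure) (p::ennreal)
      (f :: (nat \<Rightarrow> real) \<Rightarrow> real) (C2::real) (s::real) (c :: real \<Rightarrow> nat \<Rightarrow> real)
      (K0::int) (g :: (nat \<Rightarrow> complex) \<Rightarrow> real).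
    N = 2 ^ n \<and> N \<ge> 2 \<and> K = 2 ^ \<kappa> \<and> K \<le> N \<and>
    X \<subseteq> vec_cball N 1 \<and>
    prob_space P \<and> space P = X \<and>
    sets (restrict_space (Pi\<^sub>M {..<N} (\<lambda>_. borel)) X) \<subseteq> sets P \<and>
    p \<ge> 1 \<and> C2 > 0 \<and> s > 0 \<and> c s K > 0 \<and>
    Lp_norm P p (\<lambda>x. f x - g (dft_on N K K0 x)) < ennreal (1 / 10) \<and>
    (\<forall>z\<in>vec_cball K (11 / 10). \<forall>z'\<in>vec_cball K (11 / 10).
       \<bar>g z - g z'\<bar> \<le> C2 * L2_set (\<lambda>i. norm (z i - z' i)) {..<K}) \<and>
    (\<forall>\<epsilon>::real. 0 < \<epsilon> \<and> \<epsilon> < 1 \<longrightarrow>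
       (\<exists>\<Phi>. fc_scalar_net \<Phi> \<and>
          real (fc_params (2 * K) \<Phi>) \<le> c s K * \<epsilon> powr (- (real K / s)) * (log 2 (1 / \<epsilon>) + 1) \<and>
          (SUP z\<in>vec_cball K (11 / 10). ennreal \<bar>fc_map K \<Phi> z - g z\<bar>) < ennreal \<epsilon>))
    \<longrightarrow>
    (\<forall>\<epsilon>::real. 0 < \<epsilon> \<and> \<epsilon> < 1 / 10 \<and>
       Lp_norm P p (\<lambda>x. f x - g (dft_on N K K0 x)) \<le> ennreal \<epsilon> \<longrightarrow>
       (\<exists>(B :: nat \<Rightarrow> butterfly_net) \<Phi>.
          (\<forall>l\<le>\<kappa>. bf_admissible n \<kappa> (B l) \<and> Lxi (B l) = l \<and>
             real (bf_params n \<kappa> (B l))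
               \<le> C * real K * log 2 (real N) * (log 2 (1 / \<epsilon>) + log 2 (real N)) ^ 2) \<and>
          fc_scalar_net \<Phi> \<and>
          real (fc_params (2 * K) \<Phi>)
            \<le> c s K * \<epsilon> powr (- (real K / s)) * (log 2 (1 / \<epsilon>) + 1) \<and>
          (\<forall>l\<le>\<kappa>.
             (\<forall>x\<in>X. bf_map n \<kappa> (B l) x \<in> vec_cball K (11 / 10)) \<and>
             Lp_norm P p (\<lambda>x. f x - fc_map K \<Phi> (bf_map n \<kappa> (B l) x))
               \<le> ennreal (\<epsilon> * (2 + C2)))))"
proof (rule exI[of _ "200 * 39\<^sup>2"], intro allI impI, elim conjE)
  fix N K n \<kappa> :: nat and X :: "(nat \<Rightarrow> real) set" and P :: "(nat \<Rightarrow> real) measure" and p :: ennreal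
    and f :: "(nat \<Rightarrow> real) \<Rightarrow> real" and C2 s :: real and c :: "real \<Rightarrow> nat \<Rightarrow> real"
    and K0 :: int and g :: "(nat \<Rightarrow> complex) \<Rightarrow> real" and \<epsilon> :: real
  assume N: "N = 2 ^ n" "N \<ge> 2" and K: "K = 2 ^ \<kappa>" "K \<le> N"
    and P: "X \<subseteq> vec_cball N 1" "prob_space P" "space P = X"
      "sets (restrict_space (Pi\<^sub>M {..<N} (\<lambda>_. borel)) X) \<subseteq> sets P"
    and "p \<ge> 1" "C2 > 0"
    and lip: "\<forall>z\<in>vec_cball K (11 / 10). \<forall>z'\<in>vec_cball K (11 / 10).
       \<bar>g z - g z'\<bar> \<le> C2 * L2_set (\<lambda>i. norm (z i - z' i)) {..<K}"
    and nets: "\<forall>\<epsilon>::real. 0 < \<epsilon> \<and> \<epsilon> < 1 \<longrightarrow>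
       (\<exists>\<Phi>. fc_scalar_net \<Phi> \<and>
          real (fc_params (2 * K) \<Phi>) \<le> c s K * \<epsilon> powr (- (real K / s)) * (log 2 (1 / \<epsilon>) + 1) \<and>
          (SUP z\<in>vec_cball K (11 / 10). ennreal \<bar>fc_map K \<Phi> z - g z\<bar>) < ennreal \<epsilon>)"
    and \<epsilon>: "0 < \<epsilon>" "\<epsilon> < 1 / 10"
    and fg: "Lp_norm P p (\<lambda>x. f x - g (dft_on N K K0 x)) \<le> ennreal \<epsilon>"
  have \<kappa>: "\<kappa> \<le> n" using K N by simp
  have n: "n \<ge> 1" using N by (cases n) auto
  define r where "r = nat \<lceil>log 2 (1 / \<epsilon>)\<rceil> + 10 * n + 28"
  have r1: "r \<ge> 1" by (simp add: r_def)
  have small: "2 ^ (10 * n + 28) / 2 ^ r \<le> \<epsilon>"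
    and r_le: "real r \<le> 39 * (log 2 (1 / \<epsilon>) + log 2 (real N))"
    using channel_count[of \<epsilon> n] \<epsilon> n by (simp_all add: r_def N log_nat_power)
  obtain \<Phi> where \<Phi>: "fc_scalar_net \<Phi>"
      "real (fc_params (2 * K) \<Phi>) \<le> c s K * \<epsilon> powr (- (real K / s)) * (log 2 (1 / \<epsilon>) + 1)"
      "(SUP z\<in>vec_cball K (11 / 10). ennreal \<bar>fc_map K \<Phi> z - g z\<bar>) < ennreal \<epsilon>"
    using nets[rule_format, of \<epsilon>] \<epsilon> by auto
  have \<Phi>_le: "\<bar>fc_map K \<Phi> z - g z\<bar> \<le> \<epsilon>" if "z \<in> vec_cball K (11 / 10)" for z
  proof -
    have "ennreal \<bar>fc_map K \<Phi> z - g z\<bar> \<le> ennreal \<epsilon>"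
      using SUP_upper[OF that, of "\<lambda>z. ennreal \<bar>fc_map K \<Phi> z - g z\<bar>"] \<Phi>(3) by (meson le_less_trans less_imp_le)
    then show ?thesis using \<epsilon> by (simp add: ennreal_le_iff)
  qed
  \<comment> \<open>The absolute constant is \<open>200\<close> from the parameter count times the
    square of the \<open>39\<close> in the bound on \<open>r\<close>.\<close>
  have params: "real (bf_params n \<kappa> (dft_net n \<kappa> K0 r l))
      \<le> 200 * 39\<^sup>2 * real K * log 2 (real N) * (log 2 (1 / \<epsilon>) + log 2 (real N))\<^sup>2" if "l \<le> \<kappa>" for l
  proof -
    have "real (bf_params n \<kappa> (dft_net n \<kappa> K0 r l)) \<le> real (200 * (n * 2 ^ \<kappa> * r\<^sup>2))"
      using bf_params_dft_net_le[OF that \<kappa> r1 n] by (simp only: of_nat_le_iff)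
    also have "\<dots> = 200 * real K * log 2 (real N) * (real r)\<^sup>2"
      by (simp add: K N log_nat_power mult_ac)
    also have "\<dots> \<le> 200 * real K * log 2 (real N) * (39 * (log 2 (1 / \<epsilon>) + log 2 (real N)))\<^sup>2"
      using N by (intro mult_left_mono power_mono r_le) auto
    finally show ?thesis by (simp only: power_mult_distrib mult_ac)
  qed
  show "\<exists>(B :: nat \<Rightarrow> butterfly_net) \<Phi>.
          (\<forall>l\<le>\<kappa>. bf_admissible n \<kappa> (B l) \<and> Lxi (B l) = l \<and>
             real (bf_params n \<kappa> (B l))
               \<le> 200 * 39\<^sup>2 * real K * log 2 (real N) * (log 2 (1 / \<epsilon>) + log 2 (real N)) ^ 2) \<and>
          fc_scalar_net \<Phi> \<and>
          real (fc_params (2 * K) \<Phi>)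
            \<le> c s K * \<epsilon> powr (- (real K / s)) * (log 2 (1 / \<epsilon>) + 1) \<and>
          (\<forall>l\<le>\<kappa>.
             (\<forall>x\<in>X. bf_map n \<kappa> (B l) x \<in> vec_cball K (11 / 10)) \<and>
             Lp_norm P p (\<lambda>x. f x - fc_map K \<Phi> (bf_map n \<kappa> (B l) x))
               \<le> ennreal (\<epsilon> * (2 + C2)))"
  proof (intro exI[of _ "dft_net n \<kappa> K0 r"] exI[of _ \<Phi>] conjI[OF _ conjI[OF \<Phi>(1) conjI[OF \<Phi>(2)]]] allI impI)
    fix l assume l: "l \<le> \<kappa>"
    show "bf_admissible n \<kappa> (dft_net n \<kappa> K0 r l) \<and> Lxi (dft_net n \<kappa> K0 r l) = l \<and>
        real (bf_params n \<kappa> (dft_net n \<kappa> K0 r l))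
          \<le> 200 * 39\<^sup>2 * real K * log 2 (real N) * (log 2 (1 / \<epsilon>) + log 2 (real N)) ^ 2"
      using params[OF l] dft_net_shape(4)[OF l \<kappa> r1] by (simp add: dft_net_def)
    show "(\<forall>x\<in>X. bf_map n \<kappa> (dft_net n \<kappa> K0 r l) x \<in> vec_cball K (11 / 10)) \<and>
        Lp_norm P p (\<lambda>x. f x - fc_map K \<Phi> (bf_map n \<kappa> (dft_net n \<kappa> K0 r l) x)) \<le> ennreal (\<epsilon> * (2 + C2))"
      by (rule Lp_norm_dft_net_le[OF N(1) K(1) \<kappa> l r1 P \<open>p \<ge> 1\<close> \<open>C2 > 0\<close> \<epsilon> lip \<Phi>_le fg small])
  qed
qed

end
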